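(* Let $(r_k)_{k\in\mathbb{Z}}$ be covariance coefficients with $\sum_{k\in\mathbb{Z}}|r_k|<\infty$ and $r_0\neq 0$, and let $R_T$, $V_T$, $\widehat R_T^b$, $\widehat R_T^u$ be defined as in the context (all random matrices $V_T$, $T\ge1$, being defined on a common probability space). Let $N=N(T)$ be positive integers with $N/T\to c$ as $T\to\infty$, where $0<c<\infty$. Then, as $T\to\infty$, $$\left\|\widehat R^b_T-R_T\right\|\to 0\quad\text{and}\quad \left\|\widehat R^u_T-R_T\right\|\to 0\quad\text{almost surely.}$$
   Context: $(r_k)_{k\in\mathbb{Z}}$ is a doubly infinite complex sequence of covariance coefficients: for every $T\ge 1$ the $T\times T$ Toeplitz matrix $R_T$ with entries $[R_T]_{i,j}=r_{j-i}$, $0\le i,j\le T-1$, is Hermitian nonnegative definite. For each $T$, $W_T$ is an $N\times T$ random matrix with independent $\mathcal{CN}(0,1)$ (standard circularly symmetric complex Gaussian) entries, and $V_T=[v_{n,t}]_{0\le n\le N-1,\,0\le t\le T-1}=W_TR_T^{1/2}$, where $R_T^{1/2}$ is any $T\times T$ matrix with $(R_T^{1/2})^{\mathsf H}R_T^{1/2}=R_T$. No assumption is made on the joint law of $V_T$ for different $T$. For $|k|\le T-1$ put $$\hat{r}_{k,T}^b=\frac{1}{NT}\sum_{n=0}^{N-1}\sum_{t=0}^{T-1} v_{n,t+k}v_{n,t}^*\mathbf{1}_{0\le t+k\le T-1},\qquad \hat{r}_{k,T}^u=\frac{1}{N(T-|k|)}\sum_{n=0}^{N-1}\sum_{t=0}^{T-1}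 v_{n,t+k}v_{n,t}^*\mathbf{1}_{0\le t+k\le T-1},$$ and let $\widehat R^b_T$, $\widehat R^u_T$ be the $T\times T$ Toeplitz matrices with entries $[\widehat R^b_T]_{i,j}=\hat r^b_{j-i,T}$ and $[\widehat R^u_T]_{i,j}=\hat r^u_{j-i,T}$, $0\le i,j\le T-1$. $\|\cdot\|$ is the spectral norm, $(\cdot)^*$ complex conjugation and $(\cdot)^{\mathsf H}$ the Hermitian transpose. *)

theory Defs
  imports
    "HOL-Probability.Probability"
    "Jordan_Normal_Form.Schur_Decomposition"
begin

text \<open>Matrices of varying size are those of \<^typ>\<open>complex mat\<close>; rows and columns are indexed from 0.\<close>

definition toeplitz :: "nat \<Rightarrow> (int \<Rightarrow> complex) \<Rightarrow> complex mat" where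
  "toeplitz T r = Matrix.mat T T (\<lambda>(i, j). r (int j - int i))"

text \<open>
  For a square \<^term>\<open>A\<close>, the second conjunct is nonnegativity of the quadratic form of \<^term>\<open>A\<close>, the
  operation \<open>\<bullet>c\<close> conjugating its second argument; the form is real-valued by the first conjunct.
\<close>

definition hermitian_nonneg_definite :: "complex mat \<Rightarrow> bool" where
  "hermitian_nonneg_definite A \<longleftrightarrow>
     mat_adjoint A = A \<and>
     (\<forall>x \<in> carrier_vec (dim_row A). 0 \<le> Re ((A *\<^sub>v x) \<bullet>c x))"

definition covariance_coefficients :: "(int \<Rightarrow> complex) \<Rightarrow> bool" where
  "covariance_coefficients r \<longleftrightarrow> (\<forall>T\<ge>1. hermitian_nonneg_definite (toeplitz T r))"

definition euclid_norm :: "complex vec \<Rightarrow> real" where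
  "euclid_norm x = L2_set (\<lambda>i. cmod (vec_index x i)) {..<dim_vec x}"

definition spectral_norm :: "complex mat \<Rightarrow> real" where
  "spectral_norm A =
     (SUP x \<in> {x \<in> carrier_vec (dim_col A). euclid_norm x \<le> 1}. euclid_norm (A *\<^sub>v x))"

text \<open>
  The law \<open>CN(0,1)\<close>: independent real and imaginary parts, each centred normal of variance 1/2
  (the last parameter of \<^const>\<open>normal_density\<close> is the standard deviation).
\<close>

definition (in prob_space) std_complex_gaussian :: "('a \<Rightarrow> complex) \<Rightarrow> bool" where
  "std_complex_gaussian X \<longleftrightarrow>
     indep_var borel (\<lambda>\<omega>. Re (X \<omega>)) borel (\<lambda>\<omega>. Im (X \<omega>)) \<and>
     distributed M lborel (\<lambda>\<omega>. Re (X \<omega>)) (normal_density 0 (sqrt (1 / 2))) \<and>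
     distributed M lborel (\<lambda>\<omega>. Im (X \<omega>)) (normal_density 0 (sqrt (1 / 2)))"

definition (in prob_space) std_complex_gaussian_matrix ::
    "nat \<Rightarrow> nat \<Rightarrow> ('a \<Rightarrow> complex mat) \<Rightarrow> bool" where
  "std_complex_gaussian_matrix N T W \<longleftrightarrow>
     (\<forall>\<omega> \<in> space M. W \<omega> \<in> carrier_mat N T) \<and>
     (\<forall>n<N. \<forall>t<T. std_complex_gaussian (\<lambda>\<omega>. W \<omega> $$ (n, t))) \<and>
     indep_vars (\<lambda>_. borel) (\<lambda>p \<omega>. W \<omega> $$ p) ({..<N} \<times> {..<T})"

text \<open>Below, \<^term>\<open>V\<close> is an \<open>N \<times> T\<close> data matrix with \<open>N = dim_row V\<close> and \<open>T = dim_col V\<close>.\<close>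

definition lag_sum :: "complex mat \<Rightarrow> int \<Rightarrow> complex" where
  "lag_sum V k =
     (\<Sum>n<dim_row V. \<Sum>t<dim_col V.
        if 0 \<le> int t + k \<and> int t + k \<le> int (dim_col V) - 1
        then V $$ (n, nat (int t + k)) * cnj (V $$ (n, t)) else 0)"

definition biased_coeff :: "complex mat \<Rightarrow> int \<Rightarrow> complex" where
  "biased_coeff V k = lag_sum V k / (of_nat (dim_row V) * of_nat (dim_col V))"

definition unbiased_coeff :: "complex mat \<Rightarrow> int \<Rightarrow> complex" where
  "unbiased_coeff V k = lag_sum V k / (of_nat (dim_row V) * of_int (int (dim_col V) - \<bar>k\<bar>))"

definition biased_estimator :: "complex mat \<Rightarrow> complex mat" where
  "biased_estimator V = toeplitz (dim_col V) (biased_coeff V)"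

definition unbiased_estimator :: "complex mat \<Rightarrow> complex mat" where
  "unbiased_estimator V = toeplitz (dim_col V) (unbiased_coeff V)"

end

(*
  Idea.  A T x T Toeplitz matrix is a corner of a 2T x 2T circulant matrix, so its norm is at most the
  maximum of its symbol over the 2T-th roots of unity; no net argument is needed.  At such a point, with
  d_t = exp(2 pi i l t / 2T), both symbols are forms in the error E(s,t) = (empirical - true covariance) d_s cnj(d_t):
  sum E(s,t) / T (plus a bias that vanishes by dominated convergence) in the biased case and
  sum E(s,t) / (T - |s - t|) in the unbiased case.

  On A x A the error sums to (1/N) sum_n |w_n . u|^2 - |u|^2 with w_n the Gaussian rows and |u|^2 <= card A * sum |r_k|,
  so the chi-square Chernoff bound controls it.  A union bound over the roots of unity and over all A that are
  unions of two intervals (polynomially many) and Borel-Cantelli give errors at most const * T^(-1/4) * card A.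

  The weight 1 / (T - |s - t|) is a positive combination of indicators of corner triangles.  Halving a triangle
  recursively decomposes it into squares I x J, and polarization expresses E(I x J) + E(J x I) by the forms on I, J and
  their union.  This costs only a factor log(T)^2.
*)
theory Submission
  imports Defs "HOL-Real_Asymp.Real_Asymp"
begin

section \<open>Discrete Fourier analysis at the 2T-th roots of unity\<close>

section \<open>The norm of a Toeplitz matrix\<close>

text \<open>The k-th power of the L-th root of unity with index \<open>l\<close>. The exponent is an
  integer because lags are differences of time indices and may be negative.\<close>

definition unit_root :: "nat \<Rightarrow> nat \<Rightarrow> int \<Rightarrow> complex" where
  "unit_root L l k = cis (2 * pi * real l * of_int k / real L)"

lemma unit_root_add: "unit_root L l (j + k) = unit_root L l j * unit_root L l k"
  by (simp add: unit_root_def cis_mult add_divide_distrib ring_distribs)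

lemma cnj_unit_root: "cnj (unit_root L l k) = unit_root L l (- k)"
  by (simp add: unit_root_def cis_cnj)

lemma cmod_unit_root [simp]: "cmod (unit_root L l k) = 1"
  by (simp add: unit_root_def)

lemma unit_root_0 [simp]: "unit_root L l 0 = 1"
  by (simp add: unit_root_def)

text \<open>A geometric sum whose ratio is an L-th root of unity; the ratio differs from 1 because a
  nonzero k with |k| < L is no multiple of L.\<close>

lemma sum_unit_root:
  assumes "\<bar>k\<bar> < int L"
  shows "(\<Sum>l<L. unit_root L l k) = (if k = 0 then of_nat L else 0)"
proof (cases "k = 0")
  case False
  have L: "L > 0" using assms by linarith
  define z where "z = cis (2 * pi * of_int k / real L)"
  have pow: "unit_root L l k = z ^ l" for l
  proof -
    have "z ^ l = cis (real l * (2 * pi * of_int k / real L))"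
      unfolding z_def by (rule Complex.DeMoivre)
    then show ?thesis by (simp add: unit_root_def mult_ac)
  qed
  have "z \<noteq> 1"
  proof
    assume "z = 1"
    then have "cos (2 * pi * of_int k / real L) = 1"
      by (metis z_def cis.sel(1) one_complex.sel(1))
    then obtain n :: int where "2 * pi * of_int k / real L = of_int n * 2 * pi"
      using cos_one_2pi_int by blast
    then have "real_of_int k = of_int n * real L"
      using L by (simp add: field_simps)
    then have k: "k = n * int L"
      by (metis of_int_eq_iff of_int_mult of_int_of_nat_eq)
    with False have "1 \<le> \<bar>n\<bar>" by auto
    then have "int L \<le> \<bar>k\<bar>" by (simp add: k abs_mult mult_le_cancel_right1)
    with assms show False by simp
  qed
  moreover have "z ^ L = 1"
    using L cis_multiple_2pi[of "of_int k"] by (simp add: z_def Complex.DeMoivre mult.commute)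
  ultimately show ?thesis
    using False by (simp add: pow geometric_sum)
qed simp

text \<open>Parseval for a vector padded with zeros from length T to L: expanding the squares leaves
  only differences of absolute value below T, and orthogonality kills all nonzero ones.\<close>

lemma parseval_unit_root:
  fixes x :: "nat \<Rightarrow> complex"
  assumes "T \<le> L"
  shows "(\<Sum>l<L. (cmod (\<Sum>j<T. x j * unit_root L l (- int j)))\<^sup>2) = real L * (\<Sum>j<T. (cmod (x j))\<^sup>2)"
proof -
  have "complex_of_real (\<Sum>l<L. (cmod (\<Sum>j<T. x j * unit_root L l (- int j)))\<^sup>2)
      = (\<Sum>l<L. \<Sum>j<T. \<Sum>k<T. x j * cnj (x k) * unit_root L l (int k - int j))"
    unfolding of_real_sum
  proof (intro sum.cong refl)
    fix l
    have "unit_root L l (int k - int j) = unit_root L l (- int j) * unit_root L l (int k)" for j k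
      by (simp add: unit_root_add[symmetric])
    then show "complex_of_real ((cmod (\<Sum>j<T. x j * unit_root L l (- int j)))\<^sup>2)
        = (\<Sum>j<T. \<Sum>k<T. x j * cnj (x k) * unit_root L l (int k - int j))"
      unfolding complex_norm_square cnj_sum sum_product
      by (intro sum.cong refl) (simp add: cnj_unit_root)
  qed
  also have "\<dots> = (\<Sum>j<T. \<Sum>k<T. x j * cnj (x k) * (\<Sum>l<L. unit_root L l (int k - int j)))"
    by (simp add: sum_distrib_left sum.swap[of _ "{..<L}"])
  also have "\<dots> = (\<Sum>j<T. \<Sum>k<T. if k = j then x j * cnj (x k) * of_nat L else 0)"
    using assms by (intro sum.cong refl) (auto simp: sum_unit_root)
  also have "\<dots> = complex_of_real (real L * (\<Sum>j<T. (cmod (x j))\<^sup>2))"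
    by (simp add: sum.delta sum_distrib_left complex_norm_square mult.commute del: of_real_power)
  finally show ?thesis
    by (simp only: of_real_eq_iff)
qed

text \<open>This is the diagonalised circulant of size 2T compressed to a T x T corner. The form
  becomes a sum over the 2T nodes of symbol value times two transforms; Cauchy-Schwarz and Parseval
  for each vector produce a factor 2T, which cancels the one from Fourier inversion.\<close>

lemma toeplitz_form_bound:
  fixes a :: "int \<Rightarrow> complex" and x y :: "nat \<Rightarrow> complex"
  assumes T: "T \<ge> 1"
    and B: "\<And>l. l < 2 * T \<Longrightarrow> cmod (\<Sum>k\<in>{- int T<..<int T}. a k * unit_root (2 * T) l k) \<le> B"
  shows "cmod (\<Sum>i<T. \<Sum>j<T. cnj (y i) * a (int j - int i) * x j)
    \<le> B * sqrt (\<Sum>i<T. (cmod (y i))\<^sup>2) * sqrt (\<Sum>j<T. (cmod (x j))\<^sup>2)"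
proof -
  let ?u = "unit_root (2 * T)"
  define P where "P l = (\<Sum>k\<in>{- int T<..<int T}. a k * ?u l k)" for l
  define X where "X z l = (\<Sum>j<T. z j * ?u l (- int j))" for z :: "nat \<Rightarrow> complex" and l
  have u_diff: "?u l (k - m) = ?u l k * ?u l (- m)" for l k m
    by (simp add: unit_root_add[symmetric])
  \<comment> \<open>Fourier inversion without aliasing: k and m both lie strictly between -T and T,
    so |k - m| < 2T. This is why 2T nodes are taken.\<close>
  have inv: "(\<Sum>l<2 * T. P l * ?u l (- m)) = of_nat (2 * T) * a m" if "\<bar>m\<bar> < int T" for m
  proof -
    have "(\<Sum>l<2 * T. P l * ?u l (- m)) = (\<Sum>k\<in>{- int T<..<int T}. a k * (\<Sum>l<2 * T. ?u l (k - m)))"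
      unfolding P_def sum_distrib_left sum_distrib_right u_diff
      by (subst sum.swap) (simp add: mult.assoc)
    also have "\<dots> = (\<Sum>k\<in>{- int T<..<int T}. if k = m then a k * of_nat (2 * T) else 0)"
      using that by (intro sum.cong refl, subst sum_unit_root) auto
    also have "\<dots> = of_nat (2 * T) * a m"
      using that by (auto simp: sum.delta)
    finally show ?thesis .
  qed
  have "of_nat (2 * T) * (\<Sum>i<T. \<Sum>j<T. cnj (y i) * a (int j - int i) * x j)
      = (\<Sum>i<T. \<Sum>j<T. cnj (y i) * (of_nat (2 * T) * a (int j - int i)) * x j)"
    unfolding sum_distrib_left by (intro sum.cong refl) (simp add: algebra_simps)
  also have "\<dots> = (\<Sum>i<T. \<Sum>j<T. \<Sum>l<2 * T. P l * (cnj (y i) * ?u l (int i)) * (x j * ?u l (- int j)))"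
  proof (intro sum.cong refl)
    fix i j assume "i \<in> {..<T}" "j \<in> {..<T}"
    then have "of_nat (2 * T) * a (int j - int i) = (\<Sum>l<2 * T. P l * ?u l (- (int j - int i)))"
      by (intro inv[symmetric]) auto
    also have "\<dots> = (\<Sum>l<2 * T. P l * (?u l (int i) * ?u l (- int j)))"
      by (simp add: u_diff)
    finally show "cnj (y i) * (of_nat (2 * T) * a (int j - int i)) * x j
        = (\<Sum>l<2 * T. P l * (cnj (y i) * ?u l (int i)) * (x j * ?u l (- int j)))"
      by (simp only: sum_distrib_left sum_distrib_right) (simp add: mult_ac)
  qed
  also have "\<dots> = (\<Sum>l<2 * T. \<Sum>i<T. \<Sum>j<T. P l * (cnj (y i) * ?u l (int i)) * (x j * ?u l (- int j)))"
    by (simp only: sum.swap[of _ "{..<2 * T}"])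
  also have "\<dots> = (\<Sum>l<2 * T. P l * cnj (X y l) * X x l)"
  proof (intro sum.cong refl)
    fix l
    have cnjX: "cnj (X y l) = (\<Sum>i<T. cnj (y i) * ?u l (int i))"
      by (simp add: X_def cnj_unit_root)
    show "(\<Sum>i<T. \<Sum>j<T. P l * (cnj (y i) * ?u l (int i)) * (x j * ?u l (- int j))) = P l * cnj (X y l) * X x l"
      unfolding cnjX by (simp only: X_def mult.assoc[of "P l"] sum_product sum_distrib_left[symmetric])
  qed
  finally have eq: "of_nat (2 * T) * (\<Sum>i<T. \<Sum>j<T. cnj (y i) * a (int j - int i) * x j)
      = (\<Sum>l<2 * T. P l * cnj (X y l) * X x l)" .
  have B0: "0 \<le> B"
    using order_trans[OF norm_ge_zero B[of 0]] T by simp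
  have "cmod (\<Sum>l<2 * T. P l * cnj (X y l) * X x l) \<le> (\<Sum>l<2 * T. B * (cmod (X y l) * cmod (X x l)))"
    using B by (intro sum_norm_le) (auto simp: norm_mult P_def mult.assoc intro!: mult_right_mono)
  also have "\<dots> \<le> B * (L2_set (\<lambda>l. cmod (X y l)) {..<2 * T} * L2_set (\<lambda>l. cmod (X x l)) {..<2 * T})"
    unfolding sum_distrib_left[symmetric] using L2_set_mult_ineq[of "\<lambda>l. cmod (X y l)" "\<lambda>l. cmod (X x l)" "{..<2 * T}"]
    by (intro mult_left_mono B0) simp
  also have "\<dots> = B * (sqrt (real (2 * T)) * sqrt (real (2 * T)))
      * sqrt (\<Sum>i<T. (cmod (y i))\<^sup>2) * sqrt (\<Sum>j<T. (cmod (x j))\<^sup>2)"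
    by (simp add: L2_set_def X_def parseval_unit_root real_sqrt_mult)
  also have "\<dots> = real (2 * T) * (B * sqrt (\<Sum>i<T. (cmod (y i))\<^sup>2) * sqrt (\<Sum>j<T. (cmod (x j))\<^sup>2))"
    by (simp del: real_sqrt_mult)
  finally have "real (2 * T) * cmod (\<Sum>i<T. \<Sum>j<T. cnj (y i) * a (int j - int i) * x j)
     \<le> real (2 * T) * (B * sqrt (\<Sum>i<T. (cmod (y i))\<^sup>2) * sqrt (\<Sum>j<T. (cmod (x j))\<^sup>2))"
    unfolding eq[symmetric] norm_mult norm_of_nat .
  then show ?thesis
    using T by (subst (asm) mult_le_cancel_left_pos) auto
qed

text \<open>Testing the form with y = A x gives |A x|^2 <= B |A x| |x|. Nonnegativity is recorded
  too, because the later bounds are stated for the absolute value of the norm; it uses that the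
  supremum is over a bounded set containing the value at 0.\<close>

lemma spectral_norm_toeplitz_bounds:
  fixes a :: "int \<Rightarrow> complex"
  assumes T: "T \<ge> 1"
    and B: "\<And>l. l < 2 * T \<Longrightarrow> cmod (\<Sum>k\<in>{- int T<..<int T}. a k * unit_root (2 * T) l k) \<le> B"
  shows "0 \<le> spectral_norm (toeplitz T a)" "spectral_norm (toeplitz T a) \<le> B"
proof -
  let ?A = "toeplitz T a"
  let ?S = "{x \<in> carrier_vec (dim_col ?A). euclid_norm x \<le> 1}"
  have dim: "dim_row ?A = T" "dim_col ?A = T" by (simp_all add: toeplitz_def)
  have nn: "0 \<le> euclid_norm x" for x by (simp add: euclid_norm_def)
  have B0: "0 \<le> B"
    using order_trans[OF norm_ge_zero B[of 0]] T by simp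
  have bound: "euclid_norm (?A *\<^sub>v x) \<le> B" if x: "x \<in> ?S" for x
  proof -
    define y where "y = ?A *\<^sub>v x"
    have dimx: "dim_vec x = T" and dimy: "dim_vec y = T" using x dim by (auto simp: y_def)
    have y: "vec_index y i = (\<Sum>j<T. a (int j - int i) * vec_index x j)" if "i < T" for i
      using that dimx by (simp add: y_def toeplitz_def scalar_prod_def lessThan_atLeast0)
    have "complex_of_real ((euclid_norm y)\<^sup>2) = (\<Sum>i<T. cnj (vec_index y i) * vec_index y i)"
      by (simp add: euclid_norm_def L2_set_def dimy sum_nonneg complex_norm_square mult.commute del: of_real_power)
    also have "\<dots> = (\<Sum>i<T. \<Sum>j<T. cnj (vec_index y i) * a (int j - int i) * vec_index x j)"
      by (intro sum.cong refl, subst y) (auto simp: sum_distrib_left mult.assoc y)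
    finally have "(euclid_norm y)\<^sup>2 = cmod (\<Sum>i<T. \<Sum>j<T. cnj (vec_index y i) * a (int j - int i) * vec_index x j)"
      by (metis norm_of_real abs_of_nonneg zero_le_power2)
    also have "\<dots> \<le> B * euclid_norm y * euclid_norm x"
      using toeplitz_form_bound[OF T B, of "vec_index y" "vec_index x"]
      by (simp add: euclid_norm_def L2_set_def dimx dimy)
    also have "\<dots> \<le> B * euclid_norm y * 1"
      using x B0 nn by (intro mult_left_mono) auto
    finally have "euclid_norm y * euclid_norm y \<le> B * euclid_norm y" by (simp add: power2_eq_square)
    then show ?thesis
      using nn[of y] B0 unfolding y_def[symmetric]
      by (cases "euclid_norm y = 0") auto
  qed
  have zero: "0\<^sub>v T \<in> ?S" by (simp add: dim euclid_norm_def L2_set_def)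
  show "spectral_norm ?A \<le> B"
    unfolding spectral_norm_def using zero bound by (intro cSUP_least) auto
  have "euclid_norm (?A *\<^sub>v 0\<^sub>v T) \<le> spectral_norm ?A"
    unfolding spectral_norm_def using bound by (intro cSUP_upper zero bdd_aboveI2[where M = B]) auto
  then show "0 \<le> spectral_norm ?A" using nn order_trans by blast
qed

section \<open>Dyadic decomposition of triangles and summation by parts\<close>

section \<open>Forms weighted by the inverse number of samples per lag\<close>

lemma sum_lessThan_add:
  fixes f :: "nat \<Rightarrow> 'b::comm_monoid_add"
  shows "(\<Sum>i<m + n. f i) = (\<Sum>i<m. f i) + (\<Sum>i<n. f (m + i))"
  by (induction n) (simp_all add: add.assoc)

text \<open>A triangle of side m with corner (a, b) is a square of side h = ceiling(m/2) at that
  corner plus two triangles of side k = floor(m/2) with corners (a, b + h) and (a + h, b). Each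
  halving costs at most \<open>y * m\<close> in total, since h <= m and 2k <= m, and D halvings
  exhaust a side below 2^D. The summand 1 in \<open>a + b + m + 1 \<le> T\<close> pays for rounding
  h up, as 2h <= m + 1; both smaller triangles inherit the condition exactly.\<close>

lemma triangle_sum_bound:
  fixes H :: "nat \<Rightarrow> nat \<Rightarrow> complex"
  assumes sq: "\<And>a b h. a + b + 2 * h \<le> T \<Longrightarrow> cmod (\<Sum>p<h. \<Sum>q<h. H (a + p) (b + q)) \<le> y * real h"
    and y: "0 \<le> y"
  shows "m < 2 ^ D \<Longrightarrow> a + b + m + 1 \<le> T \<Longrightarrow>
    cmod (\<Sum>p<m. \<Sum>q<m - p. H (a + p) (b + q)) \<le> y * real m * real D"
proof (induction D arbitrary: a b m)
  case 0
  then show ?case by simp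
next
  case (Suc D)
  define h k where "h = (m + 1) div 2" and "k = m div 2"
  have m: "m = h + k" and kh: "k \<le> h" "h \<le> k + 1" unfolding h_def k_def by linarith+
  have k: "k < 2 ^ D" using Suc.prems(1) by (simp add: k_def less_mult_imp_div_less mult.commute)
  let ?f = "\<lambda>p. \<Sum>q<m - p. H (a + p) (b + q)"
  have split_q: "(\<Sum>q<m - p. H (a + p) (b + q))
      = (\<Sum>q<h. H (a + p) (b + q)) + (\<Sum>q<k - p. H (a + p) (b + h + q))" if "p < h" for p
  proof -
    have "m - p = h + (k - p)" using that m kh by auto
    then show ?thesis by (simp only: sum_lessThan_add add.assoc)
  qed
  have "(\<Sum>p<m. ?f p) = (\<Sum>p<h. ?f p) + (\<Sum>p<k. ?f (h + p))"
    unfolding m by (rule sum_lessThan_add)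
  also have "(\<Sum>p<h. ?f p) = (\<Sum>p<h. \<Sum>q<h. H (a + p) (b + q)) + (\<Sum>p<h. \<Sum>q<k - p. H (a + p) (b + h + q))"
    by (simp add: split_q sum.distrib)
  \<comment> \<open>When h = k + 1, the extra row p = k is empty.\<close>
  also have "(\<Sum>p<h. \<Sum>q<k - p. H (a + p) (b + h + q)) = (\<Sum>p<k. \<Sum>q<k - p. H (a + p) (b + h + q))"
    using kh by (intro sum.mono_neutral_right) auto
  also have "(\<Sum>p<k. ?f (h + p)) = (\<Sum>p<k. \<Sum>q<k - p. H (a + h + p) (b + q))"
    using m by (simp add: add.assoc)
  finally have eq: "(\<Sum>p<m. ?f p) = (\<Sum>p<h. \<Sum>q<h. H (a + p) (b + q))
      + (\<Sum>p<k. \<Sum>q<k - p. H (a + p) (b + h + q)) + (\<Sum>p<k. \<Sum>q<k - p. H (a + h + p) (b + q))" .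
  have "cmod (\<Sum>p<m. ?f p) \<le> y * real h + y * real k * real D + y * real k * real D"
    unfolding eq using Suc.prems m kh
    by (intro norm_triangle_mono sq Suc.IH k) auto
  also have "\<dots> \<le> y * real m + y * real m * real D"
  proof -
    have "y * real h \<le> y * real m" using m y by (simp add: mult_left_mono)
    moreover have "y * real D * real (k + k) \<le> y * real D * real m"
      using m kh y by (intro mult_left_mono) auto
    ultimately show ?thesis by (simp add: algebra_simps)
  qed
  finally show ?case by (simp add: algebra_simps)
qed

lemma sum_reciprocal_Suc_le_ln:
  "T \<ge> 1 \<Longrightarrow> (\<Sum>j\<in>{1..<T}. 1 / real (j + 1)) \<le> ln (real T)"
proof (induction T rule: nat_induct_at_least)
  case (Suc T)
  have "ln (real T / real (Suc T)) \<le> real T / real (Suc T) - 1"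
    using Suc.hyps by (intro ln_le_minus_one) auto
  also have "\<dots> = - (1 / real (T + 1))" by (simp add: field_simps)
  finally have "1 / real (T + 1) \<le> ln (real (Suc T)) - ln (real T)"
    using Suc.hyps by (simp add: ln_div)
  with Suc show ?case by simp
qed simp

text \<open>Read as a function of m, this writes 1/m on 1..T as a constant plus a positive
  combination of the indicators of m <= j.\<close>

lemma inverse_telescope:
  assumes "1 \<le> m" "m \<le> T"
  shows "1 / real m = 1 / real T + (\<Sum>j\<in>{m..<T}. 1 / (real j * real (j + 1)))"
  using assms(2)
proof (induction T rule: dec_induct)
  case (step n)
  have "1 / real n = 1 / real (Suc n) + 1 / (real n * real (n + 1))"
  proof -
    have "real n > 0" using assms(1) step.hyps by simp
    then have "1 / real n - 1 / real (n + 1) = 1 / (real n * real (n + 1))"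
      by (subst diff_frac_eq) auto
    then show ?thesis by simp
  qed
  with step show ?case by simp
qed simp

text \<open>By \<open>inverse_telescope\<close> the weight 1/(p+q+1) is a positive combination of
  indicators of the triangles p+q+1 <= j, so the weighted sum is one of the triangle sums
  \<open>G j\<close>. As \<open>G j\<close> is at most y j D, its coefficient 1/(j(j+1)) leaves y
  D/(j+1), and the harmonic sum gives the logarithm. The constant part 1/T, applied to the largest
  triangle, gives the summand 1.\<close>

lemma hankel_sum_bound:
  fixes H :: "nat \<Rightarrow> nat \<Rightarrow> complex"
  assumes T: "T \<ge> 1" "T \<le> 2 ^ D"
    and sq: "\<And>a b h. a + b + 2 * h \<le> T \<Longrightarrow> cmod (\<Sum>p<h. \<Sum>q<h. H (a + p) (b + q)) \<le> y * real h"
    and y: "0 \<le> y"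
  shows "cmod (\<Sum>p<T - 1. \<Sum>q<T - 1 - p. H p q / of_nat (p + q + 1)) \<le> y * real D * (1 + ln (real T))"
proof -
  define G where "G j = (\<Sum>p<j. \<Sum>q<j - p. H p q)" for j
  define c where "c j = 1 / (real j * real (j + 1))" for j
  have G: "cmod (G j) \<le> y * real j * real D" if "j < T" for j
    using triangle_sum_bound[OF sq y, where m = j and D = D and a = 0 and b = 0] that T by (simp add: G_def)
  have G_restrict: "G j = (\<Sum>p<T - 1. \<Sum>q<T - 1 - p. if p + q + 1 \<le> j then H p q else 0)" if j: "j < T" for j
  proof -
    have "(\<Sum>q<T - 1 - p. if p + q + 1 \<le> j then H p q else 0) = (\<Sum>q<j - p. H p q)" for p
      using j by (intro sum.mono_neutral_cong_right) auto
    then show ?thesis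
      unfolding G_def using j by (simp, intro sum.mono_neutral_left) auto
  qed
  have weight: "1 / of_nat (p + q + 1) = complex_of_real (1 / real T)
      + (\<Sum>j\<in>{1..<T}. if p + q + 1 \<le> j then complex_of_real (c j) else 0)"
    if "p < T - 1" "q < T - 1 - p" for p q
  proof -
    have "(\<Sum>j\<in>{1..<T}. if p + q + 1 \<le> j then complex_of_real (c j) else 0)
        = (\<Sum>j\<in>{p + q + 1..<T}. complex_of_real (c j))"
      by (intro sum.mono_neutral_cong_right) auto
    also have "\<dots> = complex_of_real (1 / real (p + q + 1) - 1 / real T)"
      using inverse_telescope[of "p + q + 1" T] that unfolding c_def of_real_sum[symmetric] by simp
    finally show ?thesis by simp
  qed
  have "(\<Sum>p<T - 1. \<Sum>q<T - 1 - p. H p q / of_nat (p + q + 1))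
      = (\<Sum>p<T - 1. \<Sum>q<T - 1 - p. complex_of_real (1 / real T) * H p q
          + (\<Sum>j\<in>{1..<T}. complex_of_real (c j) * (if p + q + 1 \<le> j then H p q else 0)))"
  proof (intro sum.cong refl)
    fix p q assume "p \<in> {..<T - 1}" "q \<in> {..<T - 1 - p}"
    then have "H p q / of_nat (p + q + 1) = H p q * (complex_of_real (1 / real T)
      + (\<Sum>j\<in>{1..<T}. if p + q + 1 \<le> j then complex_of_real (c j) else 0))"
      by (subst weight[symmetric]) auto
    then show "H p q / of_nat (p + q + 1) = complex_of_real (1 / real T) * H p q
          + (\<Sum>j\<in>{1..<T}. complex_of_real (c j) * (if p + q + 1 \<le> j then H p q else 0))"
      by (simp add: distrib_left sum_distrib_left if_distrib mult.commute cong: if_cong)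
  qed
  also have "\<dots> = complex_of_real (1 / real T) * G (T - 1) + (\<Sum>j\<in>{1..<T}. complex_of_real (c j) * G j)"
  proof -
    have "(\<Sum>p<T - 1. \<Sum>q<T - 1 - p. \<Sum>j\<in>{1..<T}. complex_of_real (c j) * (if p + q + 1 \<le> j then H p q else 0))
      = (\<Sum>j\<in>{1..<T}. complex_of_real (c j) * G j)"
      by (simp only: sum.swap[of _ "{1..<T}"] sum_distrib_left[symmetric])
        (intro sum.cong refl, simp add: G_restrict)
    then show ?thesis
      by (simp add: sum.distrib G_def sum_distrib_left)
  qed
  finally have eq: "(\<Sum>p<T - 1. \<Sum>q<T - 1 - p. H p q / of_nat (p + q + 1))
    = complex_of_real (1 / real T) * G (T - 1) + (\<Sum>j\<in>{1..<T}. complex_of_real (c j) * G j)" .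
  have "cmod (complex_of_real (1 / real T) * G (T - 1)) \<le> 1 / real T * (y * real T * real D)"
    unfolding norm_mult using T y
    by (intro mult_mono order_trans[OF G]) (auto simp: norm_divide intro!: mult_mono)
  moreover have "cmod (\<Sum>j\<in>{1..<T}. complex_of_real (c j) * G j) \<le> (\<Sum>j\<in>{1..<T}. y * real D * (1 / real (j + 1)))"
  proof (rule sum_norm_le)
    fix j assume j: "j \<in> {1..<T}"
    have "0 \<le> c j" by (simp add: c_def)
    with j have "cmod (complex_of_real (c j) * G j) \<le> c j * (y * real j * real D)"
      unfolding norm_mult norm_of_real using G[of j] by (auto intro!: mult_left_mono)
    also have "\<dots> = y * real D * (1 / real (j + 1))"
      using j by (simp add: c_def)
    finally show "cmod (complex_of_real (c j) * G j) \<le> y * real D * (1 / real (j + 1))" .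
  qed
  moreover have "(\<Sum>j\<in>{1..<T}. y * real D * (1 / real (j + 1))) \<le> y * real D * ln (real T)"
    unfolding sum_distrib_left[symmetric] using y T
    by (intro mult_left_mono sum_reciprocal_Suc_le_ln) auto
  ultimately show ?thesis
    unfolding eq using T by (intro order_trans[OF norm_triangle_ineq]) (simp add: distrib_left)
qed

text \<open>For s > t put p = t and q = T - 1 - s, the distances to the corner; then T - |s - t| = p
  + q + 1. Adding the entries at (s, t) and (t, s) turns the off-diagonal part into a
  Hankel-weighted sum. On the diagonal the weight is 1/T and one-point intervals bound each entry by
  x.\<close>

lemma inverse_lag_form_bound:
  fixes E :: "nat \<Rightarrow> nat \<Rightarrow> complex"
  assumes T: "T \<ge> 1" "T \<le> 2 ^ D"
    and E: "\<And>a b c d. \<lbrakk>a \<le> T; b \<le> T; c \<le> T; d \<le> T\<rbrakk> \<Longrightarrow>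
      cmod (\<Sum>s\<in>{a..<b} \<union> {c..<d}. \<Sum>t\<in>{a..<b} \<union> {c..<d}. E s t) \<le> x * real (card ({a..<b} \<union> {c..<d}))"
    and x: "0 \<le> x"
  shows "cmod (\<Sum>s<T. \<Sum>t<T. E s t / of_int (int T - \<bar>int s - int t\<bar>))
    \<le> x * (1 + 4 * real D * (1 + ln (real T)))"
proof -
  define F where "F A = (\<Sum>s\<in>A. \<Sum>t\<in>A. E s t)" for A
  have F_interval: "cmod (F {a..<b}) \<le> x * real (b - a)" if "a \<le> T" "b \<le> T" for a b
    using E[OF that that] by (simp add: F_def)
  have F_Un: "cmod (F ({a..<b} \<union> {c..<d})) \<le> x * (real (b - a) + real (d - c))"
    if "a \<le> T" "b \<le> T" "c \<le> T" "d \<le> T" for a b c d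
  proof -
    have "card ({a..<b} \<union> {c..<d}) \<le> (b - a) + (d - c)"
      by (rule order_trans[OF card_Un_le]) simp
    then show ?thesis
      using x by (intro order_trans[OF E[OF that, folded F_def]] mult_left_mono) linarith+
  qed
  define H where "H p q = E (T - 1 - q) p + E p (T - 1 - q)" for p q
  have sq: "cmod (\<Sum>p<h. \<Sum>q<h. H (a + p) (b + q)) \<le> (4 * x) * real h" if "a + b + 2 * h \<le> T" for a b h
  proof -
    \<comment> \<open>The square of \<open>H\<close> at (a, b) is the block I x J together with its
      transpose. The condition a + b + 2h <= T says exactly that I ends before J begins, so
      polarization applies; the factor 4 is 2 for the union and 1 for each interval.\<close>
    define I J where "I = {a..<a + h}" and "J = {T - b - h..<T - b}"
    have IJ: "I \<inter> J = {}" using that by (auto simp: I_def J_def)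
    have fin: "finite I" "finite J" by (auto simp: I_def J_def)
    have "(\<Sum>p<h. \<Sum>q<h. H (a + p) (b + q)) = (\<Sum>p<h. \<Sum>s\<in>J. E s (a + p) + E (a + p) s)"
    proof (rule sum.cong[OF refl])
      fix p
      show "(\<Sum>q<h. H (a + p) (b + q)) = (\<Sum>s\<in>J. E s (a + p) + E (a + p) s)"
        using that unfolding H_def J_def
        by (intro sum.reindex_bij_witness[where i = "\<lambda>s. T - 1 - b - s" and j = "\<lambda>q. T - 1 - (b + q)"]) auto
    qed
    also have "\<dots> = (\<Sum>t\<in>I. \<Sum>s\<in>J. E s t + E t s)"
      unfolding I_def
      by (rule sum.reindex_bij_witness[where i = "\<lambda>t. t - a" and j = "\<lambda>p. a + p"]) auto
    also have "\<dots> = F (I \<union> J) - F I - F J"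
      using IJ fin by (simp add: F_def sum.union_disjoint sum.distrib sum.swap[of _ J I])
    finally have eq: "(\<Sum>p<h. \<Sum>q<h. H (a + p) (b + q)) = F (I \<union> J) - F I - F J" .
    have "cmod (F (I \<union> J) - F I - F J) \<le> cmod (F (I \<union> J)) + cmod (F I) + cmod (F J)"
      by (meson norm_triangle_ineq4 add_right_mono order_trans)
    also have "\<dots> \<le> x * (real h + real h) + x * real h + x * real h"
      using F_Un[of a "a + h" "T - b - h" "T - b"] F_interval[of a "a + h"] F_interval[of "T - b - h" "T - b"] that
      by (intro add_mono) (auto simp: I_def J_def)
    finally show ?thesis unfolding eq by (simp add: algebra_simps)
  qed
  define w where "w s t = E s t / of_int (int T - \<bar>int s - int t\<bar>)" for s t
  have split: "(\<Sum>s<n. \<Sum>t<n. w s t) = (\<Sum>t<n. w t t) + (\<Sum>s<n. \<Sum>t<s. w s t + w t s)" for n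
    by (induction n) (simp_all add: sum.distrib algebra_simps)
  have "(\<Sum>s<T. \<Sum>t<s. w s t + w t s) = (\<Sum>t<T. \<Sum>s\<in>{t<..<T}. w s t + w t s)"
    by (subst (1 2) sum.Sigma)
      (auto intro!: sum.reindex_bij_witness[where i = "\<lambda>(t, s). (s, t)" and j = "\<lambda>(s, t). (t, s)"])
  \<comment> \<open>The index t = T - 1 has no s above it and is dropped to match the range of
    \<open>hankel_sum_bound\<close>.\<close>
  also have "\<dots> = (\<Sum>t<T - 1. \<Sum>s\<in>{t<..<T}. w s t + w t s)"
  proof (intro sum.mono_neutral_right ballI)
    fix t assume "t \<in> {..<T} - {..<T - 1}"
    then have "{t<..<T} = {}" by auto
    then show "(\<Sum>s\<in>{t<..<T}. w s t + w t s) = 0" by (simp only: sum.empty)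
  qed auto
  also have "\<dots> = (\<Sum>p<T - 1. \<Sum>q<T - 1 - p. H p q / of_nat (p + q + 1))"
  proof (rule sum.cong[OF refl], rule sum.reindex_bij_witness[where j = "\<lambda>s. T - 1 - s" and i = "\<lambda>q. T - 1 - q"])
    fix p s assume "p \<in> {..<T - 1}" "s \<in> {p<..<T}"
    moreover from this have "T - 1 - (T - 1 - s) = s" by auto
    moreover from calculation have "of_int (int T - \<bar>int s - int p\<bar>) = complex_of_nat (p + (T - 1 - s) + 1)"
      by (subst of_int_of_nat_eq[symmetric]) (simp only: of_int_eq_iff, auto)
    moreover from calculation have "of_int (int T - \<bar>int p - int s\<bar>) = complex_of_nat (p + (T - 1 - s) + 1)"
      by (simp add: abs_minus_commute)
    ultimately show "H p (T - 1 - s) / of_nat (p + (T - 1 - s) + 1) = w s p + w p s"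
      by (simp only: w_def H_def add_divide_distrib)
  qed auto
  finally have off: "(\<Sum>s<T. \<Sum>t<s. w s t + w t s) = (\<Sum>p<T - 1. \<Sum>q<T - 1 - p. H p q / of_nat (p + q + 1))" .
  have "cmod (\<Sum>t<T. w t t) \<le> (\<Sum>t<T. x / real T)"
  proof (rule sum_norm_le)
    fix t assume "t \<in> {..<T}"
    then have "cmod (E t t) \<le> x" using F_interval[of t "Suc t"] by (simp add: F_def)
    then show "cmod (w t t) \<le> x / real T"
      by (simp add: w_def norm_divide divide_right_mono)
  qed
  then have "cmod (\<Sum>t<T. w t t) \<le> x" using T by simp
  moreover have "cmod (\<Sum>s<T. \<Sum>t<s. w s t + w t s) \<le> 4 * x * real D * (1 + ln (real T))"
    unfolding off using hankel_sum_bound[OF T sq] x by simp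
  ultimately have "cmod ((\<Sum>t<T. w t t) + (\<Sum>s<T. \<Sum>t<s. w s t + w t s)) \<le> x + 4 * x * real D * (1 + ln (real T))"
    by (rule norm_triangle_mono)
  also have "\<dots> = x * (1 + 4 * real D * (1 + ln (real T)))" by (simp add: algebra_simps)
  finally show ?thesis
    by (simp only: w_def[symmetric] split)
qed

section \<open>Chernoff bounds for quadratic functions of complex Gaussian rows\<close>

section \<open>Concentration for Gaussian matrices\<close>

text \<open>Half of the estimate |ln(1 + y) - y| <= 2 y^2 at y = -2s. Its validity range |y| <= 1/2
  is the source of the restriction |s| <= 1/4.\<close>

lemma inverse_sqrt_one_minus_le:
  fixes s :: real
  assumes "\<bar>s\<bar> \<le> 1 / 4"
  shows "1 / sqrt (1 - 2 * s) \<le> exp (s + 4 * s\<^sup>2)"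
proof -
  have "\<bar>ln (1 + (- 2 * s)) - (- 2 * s)\<bar> \<le> 2 * (- 2 * s)\<^sup>2"
    using assms by (intro abs_ln_one_plus_x_minus_x_bound) simp
  then have "- ln (1 - 2 * s) \<le> 2 * (s + 4 * s\<^sup>2)"
    by (simp add: power_mult_distrib)
  moreover have pos: "0 < 1 - 2 * s" using assms by auto
  ultimately have "ln (1 / sqrt (1 - 2 * s)) \<le> s + 4 * s\<^sup>2"
    by (simp add: ln_div ln_sqrt)
  then have "exp (ln (1 / sqrt (1 - 2 * s))) \<le> exp (s + 4 * s\<^sup>2)"
    by (subst exp_le_cancel_iff)
  then show ?thesis
    using pos by (subst (asm) exp_ln) auto
qed

context prob_space
begin

text \<open>Exponential tilting turns the standard normal density into \<sigma> times the normal
  density of variance \<sigma>^2 = 1/(1 - 2s), and that factor is the value of the integral.\<close>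

lemma nn_integral_exp_std_normal_square:
  assumes X: "distributed M lborel X std_normal_density" and s: "s < 1 / 2"
  shows "(\<integral>\<^sup>+\<omega>. ennreal (exp (s * (X \<omega>)\<^sup>2)) \<partial>M) = ennreal (1 / sqrt (1 - 2 * s))"
proof -
  define \<sigma> where "\<sigma> = 1 / sqrt (1 - 2 * s)"
  have \<sigma>: "\<sigma> > 0" "\<sigma>\<^sup>2 = 1 / (1 - 2 * s)" using s by (auto simp: \<sigma>_def power_divide)
  have density: "std_normal_density x * exp (s * x\<^sup>2) = \<sigma> * normal_density 0 \<sigma> x" for x
  proof -
    have "- x\<^sup>2 / 2 + s * x\<^sup>2 = - x\<^sup>2 / (2 * \<sigma>\<^sup>2)"
      unfolding \<sigma>(2) by (simp add: field_simps)
    then have "exp (- x\<^sup>2 / 2) * exp (s * x\<^sup>2) = exp (- x\<^sup>2 / (2 * \<sigma>\<^sup>2))"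
      by (simp only: exp_add[symmetric])
    then show ?thesis
      using \<sigma>(1) by (simp add: normal_density_def real_sqrt_mult)
  qed
  have "(\<integral>\<^sup>+\<omega>. ennreal (exp (s * (X \<omega>)\<^sup>2)) \<partial>M)
      = (\<integral>\<^sup>+x. ennreal (std_normal_density x) * ennreal (exp (s * x\<^sup>2)) \<partial>lborel)"
    by (rule distributed_nn_integral[OF X, symmetric]) simp
  also have "\<dots> = (\<integral>\<^sup>+x. ennreal \<sigma> * ennreal (normal_density 0 \<sigma> x) \<partial>lborel)"
    using \<sigma> by (intro nn_integral_cong) (simp add: ennreal_mult'[symmetric] density)
  also have "\<dots> = ennreal \<sigma> * 1"
    using \<sigma> by (subst nn_integral_cmult) (simp_all add: nn_integral_eq_integral)
  finally show ?thesis by (simp add: \<sigma>_def)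
qed

lemma nn_integral_exp_centred_square_le:
  assumes X: "distributed M lborel X std_normal_density" and s: "\<bar>s\<bar> \<le> 1 / 4"
  shows "(\<integral>\<^sup>+\<omega>. ennreal (exp (s * ((X \<omega>)\<^sup>2 - 1))) \<partial>M) \<le> ennreal (exp (4 * s\<^sup>2))"
proof -
  have [measurable]: "X \<in> borel_measurable M"
    using distributed_measurable[OF X] by simp
  have "(\<integral>\<^sup>+\<omega>. ennreal (exp (s * ((X \<omega>)\<^sup>2 - 1))) \<partial>M)
      = (\<integral>\<^sup>+\<omega>. ennreal (exp (- s)) * ennreal (exp (s * (X \<omega>)\<^sup>2)) \<partial>M)"
    by (intro nn_integral_cong) (simp add: ennreal_mult'[symmetric] exp_add[symmetric] algebra_simps)
  also have "\<dots> = ennreal (exp (- s)) * ennreal (1 / sqrt (1 - 2 * s))"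
    using s by (subst nn_integral_cmult) (simp_all add: nn_integral_exp_std_normal_square[OF X])
  also have "\<dots> \<le> ennreal (exp (- s)) * ennreal (exp (s + 4 * s\<^sup>2))"
    using s by (intro mult_left_mono ennreal_leI inverse_sqrt_one_minus_le) auto
  also have "\<dots> = ennreal (exp (4 * s\<^sup>2))"
    by (simp add: ennreal_mult'[symmetric] exp_add[symmetric])
  finally show ?thesis .
qed

text \<open>Chernoff bound; the sign \<open>e\<close> treats the upper and the lower tail at
  once.\<close>

lemma chi_square_one_sided_tail:
  fixes X :: "'i \<Rightarrow> 'a \<Rightarrow> real"
  assumes I: "finite I" and ind: "indep_vars (\<lambda>_. borel) X I"
    and X: "\<And>i. i \<in> I \<Longrightarrow> distributed M lborel (X i) std_normal_density"
    and x: "0 < x" "x \<le> 1" and e: "\<bar>e\<bar> = 1"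
  shows "prob {\<omega>\<in>space M. real (card I) * x \<le> e * (\<Sum>i\<in>I. (X i \<omega>)\<^sup>2 - 1)} \<le> exp (- real (card I) * x\<^sup>2 / 16)"
proof -
  have [measurable]: "X i \<in> borel_measurable M" if "i \<in> I" for i
    using distributed_measurable[OF X[OF that]] by simp
  \<comment> \<open>The minimiser of -s x + 4 s^2, with minimum -x^2/16; x <= 1 keeps s within the
    range 1/4 of the moment bound.\<close>
  define s where "s = x / 8"
  have s: "s > 0" "\<bar>s * e\<bar> \<le> 1 / 4" using x e by (auto simp: s_def abs_mult)
  have e2: "e\<^sup>2 = 1" using e by (metis power2_abs one_power2)
  define Q where "Q \<omega> = e * (\<Sum>i\<in>I. (X i \<omega>)\<^sup>2 - 1)" for \<omega>
  have [measurable]: "Q \<in> borel_measurable M" unfolding Q_def by measurable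
  have "(\<integral>\<^sup>+\<omega>. ennreal (exp (s * Q \<omega>)) \<partial>M)
      = (\<integral>\<^sup>+\<omega>. (\<Prod>i\<in>I. ennreal (exp (s * e * ((X i \<omega>)\<^sup>2 - 1)))) \<partial>M)"
    unfolding Q_def mult.assoc[symmetric] sum_distrib_left exp_sum[OF I]
    by (intro nn_integral_cong) (simp add: prod_ennreal)
  also have "\<dots> = (\<Prod>i\<in>I. \<integral>\<^sup>+\<omega>. ennreal (exp (s * e * ((X i \<omega>)\<^sup>2 - 1))) \<partial>M)"
    by (intro indep_vars_nn_integral I indep_vars_compose2[OF ind]) auto
  also have "\<dots> \<le> (\<Prod>i\<in>I. ennreal (exp (4 * (s * e)\<^sup>2)))"
    by (intro prod_mono_ennreal nn_integral_exp_centred_square_le X s) 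
  also have "\<dots> = ennreal (exp (real (card I) * (4 * s\<^sup>2)))"
    by (simp add: ennreal_power e2 power_mult_distrib exp_of_nat_mult)
  finally have mgf: "(\<integral>\<^sup>+\<omega>. ennreal (exp (s * Q \<omega>)) \<partial>M) \<le> ennreal (exp (real (card I) * (4 * s\<^sup>2)))" .
  have "emeasure M {\<omega>\<in>space M. real (card I) * x \<le> Q \<omega>}
      \<le> ennreal (exp (- s * (real (card I) * x))) * (\<integral>\<^sup>+\<omega>. ennreal (exp (s * Q \<omega>)) * indicator (space M) \<omega> \<partial>M)"
    by (rule Chernoff_ineq_nn_integral_ge[OF s(1)]) auto
  also have "(\<integral>\<^sup>+\<omega>. ennreal (exp (s * Q \<omega>)) * indicator (space M) \<omega> \<partial>M) = (\<integral>\<^sup>+\<omega>. ennreal (exp (s * Q \<omega>)) \<partial>M)"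
    by (intro nn_integral_cong) simp
  also have "ennreal (exp (- s * (real (card I) * x))) * \<dots>
      \<le> ennreal (exp (- s * (real (card I) * x))) * ennreal (exp (real (card I) * (4 * s\<^sup>2)))"
    by (intro mult_left_mono mgf) auto
  also have "\<dots> = ennreal (exp (- real (card I) * x\<^sup>2 / 16))"
    unfolding ennreal_mult'[OF exp_ge_zero, symmetric] exp_add[symmetric]
    by (simp add: s_def power2_eq_square field_simps)
  finally show ?thesis
    unfolding Q_def emeasure_eq_measure by simp
qed

lemma chi_square_tail:
  fixes X :: "'i \<Rightarrow> 'a \<Rightarrow> real"
  assumes I: "finite I" and ind: "indep_vars (\<lambda>_. borel) X I"
    and X: "\<And>i. i \<in> I \<Longrightarrow> distributed M lborel (X i) std_normal_density"
    and x: "0 < x" "x \<le> 1"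
  shows "prob {\<omega>\<in>space M. real (card I) * x \<le> \<bar>\<Sum>i\<in>I. (X i \<omega>)\<^sup>2 - 1\<bar>} \<le> 2 * exp (- real (card I) * x\<^sup>2 / 16)"
proof -
  let ?A = "\<lambda>e. {\<omega>\<in>space M. real (card I) * x \<le> e * (\<Sum>i\<in>I. (X i \<omega>)\<^sup>2 - 1)}"
  have [measurable]: "X i \<in> borel_measurable M" if "i \<in> I" for i
    using distributed_measurable[OF X[OF that]] by simp
  have "prob {\<omega>\<in>space M. real (card I) * x \<le> \<bar>\<Sum>i\<in>I. (X i \<omega>)\<^sup>2 - 1\<bar>} \<le> prob (?A 1 \<union> ?A (- 1))"
    by (intro finite_measure_mono) (auto simp: abs_real_def split: if_splits)
  also have "\<dots> \<le> prob (?A 1) + prob (?A (- 1))"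
    by (intro measure_Un_le) auto
  also have "\<dots> \<le> exp (- real (card I) * x\<^sup>2 / 16) + exp (- real (card I) * x\<^sup>2 / 16)"
    by (intro add_mono chi_square_one_sided_tail assms) auto
  finally show ?thesis by simp
qed

text \<open>The real part of z u is a combination of two independent normals of variance 1/2. The
  cases in which a part of u vanishes are separate because a normal variable scaled by 0 has no
  density.\<close>

lemma std_complex_gaussian_Re_mult:
  assumes z: "std_complex_gaussian z" and u: "u \<noteq> 0"
  shows "distributed M lborel (\<lambda>\<omega>. Re (z \<omega> * u)) (normal_density 0 (cmod u / sqrt 2))"
proof -
  have R: "distributed M lborel (\<lambda>\<omega>. Re (z \<omega>)) (normal_density 0 (sqrt (1 / 2)))"
    and I: "distributed M lborel (\<lambda>\<omega>. Im (z \<omega>)) (normal_density 0 (sqrt (1 / 2)))"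
    and ind: "indep_var borel (\<lambda>\<omega>. Re (z \<omega>)) borel (\<lambda>\<omega>. Im (z \<omega>))"
    using z by (auto simp: std_complex_gaussian_def)
  have scale: "distributed M lborel (\<lambda>\<omega>. a * Y \<omega>) (normal_density 0 (\<bar>a\<bar> * sqrt (1 / 2)))"
    if "distributed M lborel Y (normal_density 0 (sqrt (1 / 2)))" "a \<noteq> 0" for a Y
    using normal_density_affine[OF that(1), of a 0] that(2) by simp
  have Re: "Re (z \<omega> * u) = Re u * Re (z \<omega>) + (- Im u) * Im (z \<omega>)" for \<omega> by simp
  consider "Im u = 0" | "Re u = 0" | "Re u \<noteq> 0" "Im u \<noteq> 0" by auto
  then show ?thesis
  proof cases
    case 1
    then have "Re u \<noteq> 0" "cmod u = \<bar>Re u\<bar>" using u by (auto simp: complex_eq_iff cmod_eq_Re)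
    then show ?thesis using scale[OF R, of "Re u"] 1 by (simp add: mult.commute real_sqrt_divide)
  next
    case 2
    then have "- Im u \<noteq> 0" "cmod u = \<bar>Im u\<bar>" using u by (auto simp: complex_eq_iff cmod_eq_Im)
    then show ?thesis using scale[OF I, of "- Im u"] 2 by (simp add: mult.commute real_sqrt_divide)
  next
    case 3
    have "indep_var borel ((\<lambda>v. Re u * v) \<circ> (\<lambda>\<omega>. Re (z \<omega>))) borel ((\<lambda>v. - Im u * v) \<circ> (\<lambda>\<omega>. Im (z \<omega>)))"
      by (rule indep_var_compose[OF ind]) auto
    then have "indep_var borel (\<lambda>\<omega>. Re u * Re (z \<omega>)) borel (\<lambda>\<omega>. - Im u * Im (z \<omega>))"
      by (simp add: comp_def)
    from add_indep_normal[OF this _ _ scale[OF R] scale[OF I]] 3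
    have "distributed M lborel (\<lambda>\<omega>. Re (z \<omega> * u))
        (normal_density (0 + 0) (sqrt ((\<bar>Re u\<bar> * sqrt (1 / 2))\<^sup>2 + (\<bar>- Im u\<bar> * sqrt (1 / 2))\<^sup>2)))"
      unfolding Re by simp
    also have "sqrt ((\<bar>Re u\<bar> * sqrt (1 / 2))\<^sup>2 + (\<bar>- Im u\<bar> * sqrt (1 / 2))\<^sup>2) = cmod u / sqrt 2"
      by (simp add: cmod_def power_mult_distrib real_sqrt_divide[symmetric] add_divide_distrib)
    finally show ?thesis by simp
  qed
qed

lemma Re_combination_std_complex_gaussian:
  fixes w :: "'i \<Rightarrow> 'a \<Rightarrow> complex" and u :: "'i \<Rightarrow> complex"
  assumes J: "finite J" and ind: "indep_vars (\<lambda>_. borel) w J"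
    and w: "\<And>j. j \<in> J \<Longrightarrow> std_complex_gaussian (w j)"
    and pos: "0 < (\<Sum>j\<in>J. (cmod (u j))\<^sup>2)"
  shows "distributed M lborel (\<lambda>\<omega>. Re (\<Sum>j\<in>J. w j \<omega> * u j)) (normal_density 0 (sqrt ((\<Sum>j\<in>J. (cmod (u j))\<^sup>2) / 2)))"
proof -
  \<comment> \<open>Terms with coefficient 0 are degenerate and have no density; they are removed
    before independent normals are added.\<close>
  define J' where "J' = {j\<in>J. u j \<noteq> 0}"
  have J': "finite J'" "J' \<subseteq> J" using J by (auto simp: J'_def)
  have sq: "(\<Sum>j\<in>J. (cmod (u j))\<^sup>2) = (\<Sum>j\<in>J'. (cmod (u j))\<^sup>2)"
    unfolding J'_def by (intro sum.mono_neutral_right J) auto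
  then have ne: "J' \<noteq> {}" using pos by auto
  have "indep_vars (\<lambda>_. borel) (\<lambda>j \<omega>. Re (w j \<omega> * u j)) J'"
    by (rule indep_vars_compose2[OF indep_vars_subset[OF ind J'(2)], where Y = "\<lambda>j v. Re (v * u j)"]) measurable
  then have "distributed M lborel (\<lambda>\<omega>. \<Sum>j\<in>J'. Re (w j \<omega> * u j))
      (normal_density (\<Sum>j\<in>J'. 0) (sqrt (\<Sum>j\<in>J'. (cmod (u j) / sqrt 2)\<^sup>2)))"
    using w by (intro sum_indep_normal J' ne std_complex_gaussian_Re_mult) (auto simp: J'_def)
  moreover have "(\<Sum>j\<in>J'. (cmod (u j) / sqrt 2)\<^sup>2) = (\<Sum>j\<in>J. (cmod (u j))\<^sup>2) / 2"
    by (simp add: sq power_divide sum_divide_distrib)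
  moreover have "(\<Sum>j\<in>J'. Re (w j \<omega> * u j)) = Re (\<Sum>j\<in>J. w j \<omega> * u j)" for \<omega>
    unfolding Re_sum J'_def by (intro sum.mono_neutral_left J) auto
  ultimately show ?thesis by simp
qed

text \<open>The n-th linear form reads only the block \<open>K n\<close> of entries. The blocks are
  disjoint, so the forms are independent, and division by the standard deviation makes them standard
  normal.\<close>

lemma gaussian_matrix_Re_tail:
  fixes W :: "'a \<Rightarrow> complex mat" and u :: "nat \<Rightarrow> complex"
  assumes W: "std_complex_gaussian_matrix N T W"
    and \<sigma>2: "\<sigma>2 = (\<Sum>t<T. (cmod (u t))\<^sup>2)" "0 < \<sigma>2" and x: "0 < x" "x \<le> 1"
  shows "prob {\<omega>\<in>space M. real N * x \<le> \<bar>\<Sum>n<N. (Re (\<Sum>t<T. W \<omega> $$ (n, t) * u t) / sqrt (\<sigma>2 / 2))\<^sup>2 - 1\<bar>}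
    \<le> 2 * exp (- real N * x\<^sup>2 / 16)"
proof -
  define K where "K n = {n} \<times> {..<T}" for n :: nat
  have K: "K n = Pair n ` {..<T}" for n by (auto simp: K_def)
  have row: "(\<Sum>p\<in>K n. f p) = (\<Sum>t<T. f (n, t))" for f :: "nat \<times> nat \<Rightarrow> 'c::comm_monoid_add" and n
    unfolding K by (subst sum.reindex) (auto simp: inj_on_def)
  have ind: "indep_vars (\<lambda>_. borel) (\<lambda>p \<omega>. W \<omega> $$ p) ({..<N} \<times> {..<T})"
    and G: "\<And>p. p \<in> {..<N} \<times> {..<T} \<Longrightarrow> std_complex_gaussian (\<lambda>\<omega>. W \<omega> $$ p)"
    using W by (auto simp: std_complex_gaussian_matrix_def)
  define X where "X n \<omega> = Re (\<Sum>p\<in>K n. W \<omega> $$ p * u (snd p)) / sqrt (\<sigma>2 / 2)" for n \<omega>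
  have X_eq: "X n \<omega> = Re (\<Sum>t<T. W \<omega> $$ (n, t) * u t) / sqrt (\<sigma>2 / 2)" for n \<omega>
    unfolding X_def by (subst row) simp
  have "indep_vars (\<lambda>j. PiM (K j) (\<lambda>_. borel)) (\<lambda>j \<omega>. restrict (\<lambda>p. W \<omega> $$ p) (K j)) {..<N}"
    by (rule indep_vars_restrict[OF ind]) (auto simp: K_def disjoint_family_on_def)
  then have "indep_vars (\<lambda>_. borel) (\<lambda>j \<omega>. Re (\<Sum>p\<in>K j. restrict (\<lambda>p. W \<omega> $$ p) (K j) p * u (snd p)) / sqrt (\<sigma>2 / 2)) {..<N}"
    by (rule indep_vars_compose2[where Y = "\<lambda>j f. Re (\<Sum>p\<in>K j. f p * u (snd p)) / sqrt (\<sigma>2 / 2)"]) measurable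
  then have indX: "indep_vars (\<lambda>_. borel) X {..<N}"
    unfolding X_def by simp
  have "distributed M lborel (X n) std_normal_density" if n: "n < N" for n
  proof -
    have Kn: "K n \<subseteq> {..<N} \<times> {..<T}" "finite (K n)" using n by (auto simp: K_def)
    have eq: "(\<Sum>p\<in>K n. (cmod (u (snd p)))\<^sup>2) = \<sigma>2" by (simp add: row \<sigma>2(1))
    have Gn: "std_complex_gaussian (\<lambda>\<omega>. W \<omega> $$ p)" if "p \<in> K n" for p
      using G Kn(1) that by blast
    have "distributed M lborel (\<lambda>\<omega>. Re (\<Sum>p\<in>K n. W \<omega> $$ p * u (snd p))) (normal_density 0 (sqrt (\<sigma>2 / 2)))"
      using Re_combination_std_complex_gaussian[OF Kn(2) indep_vars_subset[OF ind Kn(1)] Gn, of "u \<circ> snd"] \<sigma>2(2)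
      by (simp only: eq comp_def)
    then show ?thesis
      using \<sigma>2(2) unfolding X_def by (subst (asm) normal_standard_normal_convert) auto
  qed
  then show ?thesis
    using chi_square_tail[OF _ indX _ x] by (simp add: X_eq)
qed

lemma std_complex_gaussian_matrix_measurable:
  assumes "std_complex_gaussian_matrix N T W" "n < N" "t < T"
  shows "(\<lambda>\<omega>. W \<omega> $$ (n, t)) \<in> borel_measurable M"
  using assms unfolding std_complex_gaussian_matrix_def indep_vars_def by auto

text \<open>The squared modulus splits into real and imaginary parts, and a deviation of the sum
  forces one of the same relative size in one part; the two tails give the factor 4. The inequality
  in the event is strict so that the event is empty when \<open>\<sigma>2\<close> is 0.\<close>

lemma gaussian_matrix_concentration:
  fixes W :: "'a \<Rightarrow> complex mat" and u :: "nat \<Rightarrow> complex"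
  assumes W: "std_complex_gaussian_matrix N T W"
    and \<sigma>2: "\<sigma>2 = (\<Sum>t<T. (cmod (u t))\<^sup>2)" and x: "0 < x" "x \<le> 1"
  shows "prob {\<omega>\<in>space M. real N * \<sigma>2 * x < \<bar>\<Sum>n<N. (cmod (\<Sum>t<T. W \<omega> $$ (n, t) * u t))\<^sup>2 - \<sigma>2\<bar>}
    \<le> 4 * exp (- real N * x\<^sup>2 / 16)"
proof (cases "\<sigma>2 = 0")
  case True
  then have "u t = 0" if "t < T" for t
    using that \<sigma>2 by (simp add: sum_nonneg_eq_0_iff)
  then show ?thesis using True by simp
next
  case False
  then have pos: "\<sigma>2 > 0" using \<sigma>2 by (simp add: sum_nonneg less_le)
  define Z where "Z n \<omega> = (\<Sum>t<T. W \<omega> $$ (n, t) * u t)" for n \<omega>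
  \<comment> \<open>Multiplication by -i turns imaginary parts into real parts, so the bound for
    real parts serves twice.\<close>
  define u' where "u' t = - \<i> * u t" for t
  have \<sigma>2': "\<sigma>2 = (\<Sum>t<T. (cmod (u' t))\<^sup>2)" by (simp add: \<sigma>2 u'_def norm_mult)
  have Im: "Im (Z n \<omega>) = Re (\<Sum>t<T. W \<omega> $$ (n, t) * u' t)" for n \<omega>
    by (simp add: Z_def u'_def Im_sum Re_sum algebra_simps)
  let ?R = "\<lambda>\<omega>. \<Sum>n<N. (Re (Z n \<omega>) / sqrt (\<sigma>2 / 2))\<^sup>2 - 1"
  let ?I = "\<lambda>\<omega>. \<Sum>n<N. (Im (Z n \<omega>) / sqrt (\<sigma>2 / 2))\<^sup>2 - 1"
  have [measurable]: "(\<lambda>\<omega>. W \<omega> $$ (n, t)) \<in> borel_measurable M" if "n < N" "t < T" for n t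
    by (rule std_complex_gaussian_matrix_measurable[OF W that])
  have [measurable]: "Z n \<in> borel_measurable M" if "n < N" for n
    using that unfolding Z_def by (intro borel_measurable_sum borel_measurable_times) auto
  have [measurable]: "?R \<in> borel_measurable M" "?I \<in> borel_measurable M"
    by (auto intro!: borel_measurable_sum measurable_compose[OF _ borel_measurable_Re] measurable_compose[OF _ borel_measurable_Im]
        borel_measurable_diff borel_measurable_power borel_measurable_divide)
  have split: "(\<Sum>n<N. (cmod (Z n \<omega>))\<^sup>2 - \<sigma>2) = \<sigma>2 / 2 * (?R \<omega> + ?I \<omega>)" for \<omega>
    unfolding sum.distrib[symmetric] sum_distrib_left using pos
    by (intro sum.cong refl) (simp add: cmod_power2 power_divide field_simps)
  have "prob {\<omega>\<in>space M. real N * \<sigma>2 * x < \<bar>\<Sum>n<N. (cmod (Z n \<omega>))\<^sup>2 - \<sigma>2\<bar>}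
      \<le> prob ({\<omega>\<in>space M. real N * x \<le> \<bar>?R \<omega>\<bar>} \<union> {\<omega>\<in>space M. real N * x \<le> \<bar>?I \<omega>\<bar>})"
  proof (intro finite_measure_mono subsetI)
    fix \<omega> assume \<omega>: "\<omega> \<in> {\<omega>\<in>space M. real N * \<sigma>2 * x < \<bar>\<Sum>n<N. (cmod (Z n \<omega>))\<^sup>2 - \<sigma>2\<bar>}"
    then have "\<sigma>2 / 2 * (2 * (real N * x)) < \<sigma>2 / 2 * \<bar>?R \<omega> + ?I \<omega>\<bar>"
      using pos by (simp add: split abs_mult mult_ac)
    then have "2 * (real N * x) < \<bar>?R \<omega> + ?I \<omega>\<bar>"
      using pos by (subst (asm) mult_less_cancel_left_pos) auto
    then have "real N * x \<le> \<bar>?R \<omega>\<bar> \<or> real N * x \<le> \<bar>?I \<omega>\<bar>" by linarith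
    then show "\<omega> \<in> {\<omega>\<in>space M. real N * x \<le> \<bar>?R \<omega>\<bar>} \<union> {\<omega>\<in>space M. real N * x \<le> \<bar>?I \<omega>\<bar>}"
      using \<omega> by blast
  qed measurable
  also have "\<dots> \<le> prob {\<omega>\<in>space M. real N * x \<le> \<bar>?R \<omega>\<bar>} + prob {\<omega>\<in>space M. real N * x \<le> \<bar>?I \<omega>\<bar>}"
    by (intro measure_Un_le) measurable
  also have "\<dots> \<le> 2 * exp (- real N * x\<^sup>2 / 16) + 2 * exp (- real N * x\<^sup>2 / 16)"
    by (intro add_mono gaussian_matrix_Re_tail[OF W \<sigma>2 pos x, folded Z_def]
        gaussian_matrix_Re_tail[OF W \<sigma>2' pos x, folded Im])
  finally show ?thesis by (simp add: Z_def)
qed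

text \<open>Union bound over the finite family \<open>P\<close>. The exceptional event is returned
  as a measurable set, so that the conclusions drawn outside it need no measurability.\<close>

lemma gaussian_matrix_uniform_concentration:
  fixes W :: "'a \<Rightarrow> complex mat" and u :: "'p \<Rightarrow> nat \<Rightarrow> complex"
  assumes W: "std_complex_gaussian_matrix N T W" and P: "finite P" and x: "0 < x" "x \<le> 1"
    and \<sigma>2: "\<And>p. p \<in> P \<Longrightarrow> \<sigma>2 p = (\<Sum>t<T. (cmod (u p t))\<^sup>2)"
  obtains B where "B \<in> events" "prob B \<le> real (card P) * (4 * exp (- real N * x\<^sup>2 / 16))"
    "\<And>\<omega> p. \<lbrakk>\<omega> \<in> space M - B; p \<in> P\<rbrakk> \<Longrightarrow>
      \<bar>\<Sum>n<N. (cmod (\<Sum>t<T. W \<omega> $$ (n, t) * u p t))\<^sup>2 - \<sigma>2 p\<bar> \<le> real N * \<sigma>2 p * x"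
proof -
  define Q where "Q p \<omega> = (\<Sum>n<N. (cmod (\<Sum>t<T. W \<omega> $$ (n, t) * u p t))\<^sup>2 - \<sigma>2 p)" for p \<omega>
  define A where "A p = {\<omega>\<in>space M. real N * \<sigma>2 p * x < \<bar>Q p \<omega>\<bar>}" for p
  have [measurable]: "Q p \<in> borel_measurable M" for p
    unfolding Q_def
    by (intro borel_measurable_sum borel_measurable_diff borel_measurable_power borel_measurable_times
        measurable_compose[OF _ borel_measurable_norm] std_complex_gaussian_matrix_measurable[OF W]) auto
  have A: "A p \<in> events" for p unfolding A_def by measurable
  show ?thesis
  proof (rule that)
    show "(\<Union>p\<in>P. A p) \<in> events" using P A by auto
    have "prob (\<Union>p\<in>P. A p) \<le> (\<Sum>p\<in>P. prob (A p))"
      using P A by (intro measure_UNION_le) auto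
    also have "\<dots> \<le> (\<Sum>p\<in>P. 4 * exp (- real N * x\<^sup>2 / 16))"
      unfolding A_def Q_def using x by (intro sum_mono gaussian_matrix_concentration[OF W \<sigma>2]) auto
    finally show "prob (\<Union>p\<in>P. A p) \<le> real (card P) * (4 * exp (- real N * x\<^sup>2 / 16))" by simp
  qed (auto simp: A_def Q_def not_less)
qed

end

section \<open>Symbols of the two estimation errors, and the bias\<close>

section \<open>From the estimators to the covariance error\<close>

text \<open>Change of variables s = t + k; the condition on t + k keeps s among the T time
  indices.\<close>

lemma sum_lags:
  fixes f :: "nat \<Rightarrow> nat \<Rightarrow> int \<Rightarrow> complex"
  shows "(\<Sum>k\<in>{- int T<..<int T}. \<Sum>t<T. if 0 \<le> int t + k \<and> int t + k \<le> int T - 1 then f (nat (int t + k)) t k else 0)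
    = (\<Sum>s<T. \<Sum>t<T. f s t (int s - int t))"
proof -
  have "(\<Sum>k\<in>{- int T<..<int T}. if 0 \<le> int t + k \<and> int t + k \<le> int T - 1 then f (nat (int t + k)) t k else 0)
      = (\<Sum>s<T. f s t (int s - int t))" if "t < T" for t
  proof -
    have "(\<Sum>s<T. f s t (int s - int t))
        = (\<Sum>k\<in>{k\<in>{- int T<..<int T}. 0 \<le> int t + k \<and> int t + k \<le> int T - 1}. f (nat (int t + k)) t k)"
      using that by (intro sum.reindex_bij_witness[where j = "\<lambda>s. int s - int t" and i = "\<lambda>k. nat (int t + k)"]) auto
    then show ?thesis by (simp only: sum.inter_filter[OF finite_greaterThanLessThan_int])
  qed
  then show ?thesis
    by (subst sum.swap, subst (2) sum.swap) simp
qed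

text \<open>For V = W S with S a factor of the Toeplitz matrix, the products have expectation r(s -
  t), so this is the centred empirical covariance of columns s and t.\<close>

definition covariance_error :: "complex mat \<Rightarrow> (int \<Rightarrow> complex) \<Rightarrow> nat \<Rightarrow> nat \<Rightarrow> complex" where
  "covariance_error V r s t =
     (\<Sum>n<dim_row V. V $$ (n, s) * cnj (V $$ (n, t))) / of_nat (dim_row V) - r (int s - int t)"

lemma card_lag:
  assumes "\<bar>k\<bar> < int T"
  shows "int (card {t\<in>{..<T}. 0 \<le> int t + k \<and> int t + k \<le> int T - 1}) = int T - \<bar>k\<bar>"
proof -
  have "{t\<in>{..<T}. 0 \<le> int t + k \<and> int t + k \<le> int T - 1} = {nat (- k)..<T - nat k}"
    using assms by auto
  then show ?thesis using assms by simp
qed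

text \<open>Exactly T - |k| times contribute at lag k, so subtracting that multiple of r k centres
  every single product.\<close>

lemma lag_sum_centred:
  assumes k: "\<bar>k\<bar> < int (dim_col V)"
  shows "lag_sum V k / of_nat (dim_row V) - of_int (int (dim_col V) - \<bar>k\<bar>) * r k
    = (\<Sum>t<dim_col V. if 0 \<le> int t + k \<and> int t + k \<le> int (dim_col V) - 1
         then covariance_error V r (nat (int t + k)) t else 0)"
proof -
  let ?N = "dim_row V" and ?T = "dim_col V"
  let ?P = "\<lambda>t. 0 \<le> int t + k \<and> int t + k \<le> int ?T - 1"
  have "lag_sum V k / of_nat ?N = (\<Sum>t<?T. if ?P t
      then (\<Sum>n<?N. V $$ (n, nat (int t + k)) * cnj (V $$ (n, t))) / of_nat ?N else 0)"
    unfolding lag_sum_def by (subst sum.swap) (auto simp: sum_divide_distrib intro!: sum.cong)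
  moreover have "of_int (int ?T - \<bar>k\<bar>) * r k = (\<Sum>t<?T. if ?P t then r k else 0)"
    unfolding card_lag[OF k, symmetric] by (simp add: sum.inter_filter[symmetric])
  ultimately show ?thesis
    by (simp only: sum_subtractf[symmetric]) (auto simp: covariance_error_def intro!: sum.cong)
qed

text \<open>Serves both estimators: w k is 1/(T - |k|) in the unbiased case and 1/T in the biased
  case.\<close>

lemma weighted_lag_sum:
  assumes T: "T = dim_col V"
  shows "(\<Sum>k\<in>{- int T<..<int T}. w k * (lag_sum V k / of_nat (dim_row V) - of_int (int T - \<bar>k\<bar>) * r k) * unit_root L l k)
    = (\<Sum>s<T. \<Sum>t<T. w (int s - int t) * (covariance_error V r s t * unit_root L l (int s - int t)))"
proof -
  have "(\<Sum>k\<in>{- int T<..<int T}. w k * (lag_sum V k / of_nat (dim_row V) - of_int (int T - \<bar>k\<bar>) * r k) * unit_root L l k)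
      = (\<Sum>k\<in>{- int T<..<int T}. \<Sum>t<T. if 0 \<le> int t + k \<and> int t + k \<le> int T - 1
         then w k * (covariance_error V r (nat (int t + k)) t * unit_root L l k) else 0)"
    by (intro sum.cong refl, unfold T, subst lag_sum_centred)
      (auto simp: sum_distrib_left sum_distrib_right mult.assoc intro!: sum.cong)
  then show ?thesis
    by (simp only: sum_lags[where f = "\<lambda>s t k. w k * (covariance_error V r s t * unit_root L l k)"])
qed

text \<open>The good event for one data matrix. Unions of two intervals are what polarization needs;
  as intervals may be empty or coincide, single intervals and the full index range are
  included.\<close>

definition uniform_error_le :: "complex mat \<Rightarrow> (int \<Rightarrow> complex) \<Rightarrow> real \<Rightarrow> bool" where
  "uniform_error_le V r x \<longleftrightarrow> (\<forall>l < 2 * dim_col V. \<forall>a b c d. a \<le> dim_col V \<longrightarrow> b \<le> dim_col V \<longrightarrow>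
     c \<le> dim_col V \<longrightarrow> d \<le> dim_col V \<longrightarrow>
     cmod (\<Sum>s\<in>{a..<b} \<union> {c..<d}. \<Sum>t\<in>{a..<b} \<union> {c..<d}.
       covariance_error V r s t * unit_root (2 * dim_col V) l (int s - int t)) \<le> x * real (card ({a..<b} \<union> {c..<d})))"

lemma uniform_error_leD:
  assumes "uniform_error_le V r x" "T = dim_col V" "l < 2 * T" "a \<le> T" "b \<le> T" "c \<le> T" "d \<le> T"
  shows "cmod (\<Sum>s\<in>{a..<b} \<union> {c..<d}. \<Sum>t\<in>{a..<b} \<union> {c..<d}.
       covariance_error V r s t * unit_root (2 * T) l (int s - int t)) \<le> x * real (card ({a..<b} \<union> {c..<d}))"
  using assms by (simp add: uniform_error_le_def)

lemma toeplitz_diff: "toeplitz T a - toeplitz T b = toeplitz T (\<lambda>k. a k - b k)"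
  by (rule eq_matI) (auto simp: toeplitz_def)

lemma unbiased_estimator_error:
  assumes T: "T = dim_col V" "T \<ge> 1" "T \<le> 2 ^ D" and N: "dim_row V > 0"
    and good: "uniform_error_le V r x" and x: "0 \<le> x"
  shows "\<bar>spectral_norm (unbiased_estimator V - toeplitz T r)\<bar> \<le> x * (1 + 4 * real D * (1 + ln (real T)))"
proof -
  have "cmod (\<Sum>k\<in>{- int T<..<int T}. (unbiased_coeff V k - r k) * unit_root (2 * T) l k)
      \<le> x * (1 + 4 * real D * (1 + ln (real T)))" if l: "l < 2 * T" for l
  proof -
    have "(\<Sum>k\<in>{- int T<..<int T}. (unbiased_coeff V k - r k) * unit_root (2 * T) l k)
      = (\<Sum>k\<in>{- int T<..<int T}. 1 / of_int (int T - \<bar>k\<bar>)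
          * (lag_sum V k / of_nat (dim_row V) - of_int (int T - \<bar>k\<bar>) * r k) * unit_root (2 * T) l k)"
    proof (rule sum.cong[OF refl])
      fix k assume "k \<in> {- int T<..<int T}"
      then have "complex_of_int (int T - \<bar>k\<bar>) \<noteq> 0"
        by (subst of_int_eq_0_iff) auto
      then show "(unbiased_coeff V k - r k) * unit_root (2 * T) l k = 1 / of_int (int T - \<bar>k\<bar>)
          * (lag_sum V k / of_nat (dim_row V) - of_int (int T - \<bar>k\<bar>) * r k) * unit_root (2 * T) l k"
        unfolding unbiased_coeff_def T(1)[symmetric] using N by (simp add: field_simps)
    qed
    also have "\<dots> = (\<Sum>s<T. \<Sum>t<T. (covariance_error V r s t * unit_root (2 * T) l (int s - int t))
        / of_int (int T - \<bar>int s - int t\<bar>))"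
      unfolding weighted_lag_sum[OF T(1)] by simp
    finally show ?thesis
      using inverse_lag_form_bound[OF T(2,3) _ x,
          of "\<lambda>s t. covariance_error V r s t * unit_root (2 * T) l (int s - int t)"]
        uniform_error_leD[OF good T(1) l] by simp
  qed
  from spectral_norm_toeplitz_bounds[OF T(2) this] show ?thesis
    by (simp add: unbiased_estimator_def T(1)[symmetric] toeplitz_diff)
qed

text \<open>Relative to T - |k| samples, division by T shrinks the mean to (1 - |k|/T) r k. The
  centred part is the error form on the full square divided by T, and the remainder is the bias
  sum.\<close>

lemma biased_estimator_error:
  assumes T: "T = dim_col V" "T \<ge> 1" and N: "dim_row V > 0"
    and good: "uniform_error_le V r x"
  shows "\<bar>spectral_norm (biased_estimator V - toeplitz T r)\<bar>
    \<le> x + (\<Sum>k\<in>{- int T<..<int T}. real_of_int \<bar>k\<bar> / real T * cmod (r k))"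
proof -
  have "cmod (\<Sum>k\<in>{- int T<..<int T}. (biased_coeff V k - r k) * unit_root (2 * T) l k)
      \<le> x + (\<Sum>k\<in>{- int T<..<int T}. real_of_int \<bar>k\<bar> / real T * cmod (r k))" if l: "l < 2 * T" for l
  proof -
    \<comment> \<open>The full range is written as a union with itself to fit the shape in
      \<open>uniform_error_le\<close>.\<close>
    define F where "F = (\<Sum>s\<in>{0..<T} \<union> {0..<T}. \<Sum>t\<in>{0..<T} \<union> {0..<T}.
       covariance_error V r s t * unit_root (2 * T) l (int s - int t))"
    have F: "cmod F \<le> x * real T"
      using uniform_error_leD[OF good T(1) l, of 0 T 0 T] by (simp add: F_def)
    have "(\<Sum>k\<in>{- int T<..<int T}. (biased_coeff V k - r k) * unit_root (2 * T) l k)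
      = (\<Sum>k\<in>{- int T<..<int T}. 1 / of_nat T
          * (lag_sum V k / of_nat (dim_row V) - of_int (int T - \<bar>k\<bar>) * r k) * unit_root (2 * T) l k
          - of_int \<bar>k\<bar> / of_nat T * r k * unit_root (2 * T) l k)"
      unfolding biased_coeff_def T(1)[symmetric] using N T(2)
      by (intro sum.cong refl) (simp add: field_simps)
    also have "\<dots> = F / of_nat T - (\<Sum>k\<in>{- int T<..<int T}. of_int \<bar>k\<bar> / of_nat T * r k * unit_root (2 * T) l k)"
      unfolding sum_subtractf weighted_lag_sum[OF T(1)] F_def
      by (simp add: sum_divide_distrib lessThan_atLeast0)
    also have "cmod \<dots> \<le> cmod (F / of_nat T) + cmod (\<Sum>k\<in>{- int T<..<int T}. of_int \<bar>k\<bar> / of_nat T * r k * unit_root (2 * T) l k)"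
      by (rule norm_triangle_ineq4)
    also have "\<dots> \<le> x + (\<Sum>k\<in>{- int T<..<int T}. real_of_int \<bar>k\<bar> / real T * cmod (r k))"
      using F T(2) by (intro add_mono sum_norm_le) (auto simp: norm_mult norm_divide field_simps)
    finally show ?thesis .
  qed
  from spectral_norm_toeplitz_bounds[OF T(2) this] show ?thesis
    by (simp add: biased_estimator_def T(1)[symmetric] toeplitz_diff)
qed

text \<open>Dominated convergence for the counting measure on the integers: each term tends to 0 for
  fixed k, and |k|/T <= 1 on the range gives the majorant |r k|.\<close>

lemma bias_tendsto_0:
  fixes r :: "int \<Rightarrow> complex"
  assumes "(\<lambda>k. cmod (r k)) summable_on UNIV"
  shows "(\<lambda>T. \<Sum>k\<in>{- int T<..<int T}. real_of_int \<bar>k\<bar> / real T * cmod (r k)) \<longlonglongrightarrow> 0"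
proof -
  define f where "f T k = (if k \<in> {- int T<..<int T} then real_of_int \<bar>k\<bar> / real T * cmod (r k) else 0)" for T k
  have "Infinite_Set_Sum.abs_summable_on (\<lambda>k. cmod (r k)) UNIV"
    using assms by (subst abs_summable_equivalent[symmetric]) simp
  then have int: "integrable (count_space UNIV) (\<lambda>k. cmod (r k))"
    by (simp add: abs_summable_on_def)
  have "(\<lambda>T. \<integral>k. f T k \<partial>count_space UNIV) \<longlonglongrightarrow> (\<integral>k. 0 \<partial>count_space (UNIV :: int set))"
  proof (rule integral_dominated_convergence[OF _ _ int])
    show "AE k in count_space UNIV. (\<lambda>T. f T k) \<longlonglongrightarrow> 0"
    proof (rule AE_I2)
      fix k :: int
      have "(\<lambda>T. \<bar>real_of_int \<bar>k\<bar> * cmod (r k)\<bar> / real T) \<longlonglongrightarrow> 0" by real_asymp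
      then show "(\<lambda>T. f T k) \<longlonglongrightarrow> 0"
        by (rule Lim_null_comparison[rotated]) (auto simp: f_def abs_mult)
    qed
    show "AE k in count_space UNIV. norm (f T k) \<le> cmod (r k)" for T
    proof (rule AE_I2)
      fix k :: int
      have "real_of_int \<bar>k\<bar> / real T * cmod (r k) \<le> 1 * cmod (r k)" if "k \<in> {- int T<..<int T}"
      proof (rule mult_right_mono)
        have "\<bar>k\<bar> \<le> int T" using that by auto
        then have "real_of_int \<bar>k\<bar> \<le> real T" by linarith
        moreover have "real T > 0" using that by auto
        ultimately show "real_of_int \<bar>k\<bar> / real T \<le> 1" by (simp add: divide_le_eq_1)
      qed simp
      then show "norm (f T k) \<le> cmod (r k)"
        by (simp add: f_def abs_mult)
    qed
  qed auto
  moreover have "(\<integral>k. f T k \<partial>count_space UNIV) = (\<Sum>k\<in>{- int T<..<int T}. real_of_int \<bar>k\<bar> / real T * cmod (r k))" for T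
  proof -
    have "(\<integral>k. f T k \<partial>count_space UNIV) = (\<Sum>k\<in>{k. f T k \<noteq> 0}. f T k)"
    proof -
      have "finite {k. f T k \<noteq> 0}"
        by (rule finite_subset[of _ "{- int T<..<int T}"]) (auto simp: f_def)
      then show ?thesis
        using lebesgue_integral_count_space_finite_support[of UNIV "f T"] by simp
    qed
    also have "\<dots> = (\<Sum>k\<in>{- int T<..<int T}. real_of_int \<bar>k\<bar> / real T * cmod (r k))"
      by (intro sum.mono_neutral_cong_left) (auto simp: f_def)
    finally show ?thesis .
  qed
  ultimately show ?thesis by simp
qed

section \<open>Variance of the forms and the union bound over frequencies and intervals\<close>

section \<open>Uniform control of the covariance error\<close>

lemma gram_toeplitz_entry:
  assumes S: "S \<in> carrier_mat T T" and R: "mat_adjoint S * S = toeplitz T r" and ij: "i < T" "j < T"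
  shows "(\<Sum>m<T. S $$ (m, j) * cnj (S $$ (m, i))) = r (int j - int i)"
proof -
  have "r (int j - int i) = (mat_adjoint S * S) $$ (i, j)"
    unfolding R using ij by (simp add: toeplitz_def)
  also have "\<dots> = (\<Sum>m<T. S $$ (m, j) * cnj (S $$ (m, i)))"
    using S ij
    by (auto simp: mat_adjoint_def scalar_prod_def lessThan_atLeast0 mat_of_rows_def mult.commute intro!: sum.cong)
  finally show ?thesis by simp
qed

lemma sq_cmod_sum_unit_root:
  "complex_of_real ((cmod (\<Sum>s\<in>A. f s * unit_root L l (int s)))\<^sup>2)
    = (\<Sum>s\<in>A. \<Sum>t\<in>A. f s * cnj (f t) * unit_root L l (int s - int t))"
proof -
  have "unit_root L l (int s - int t) = unit_root L l (int s) * unit_root L l (- int t)" for s t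
    by (simp add: unit_root_add[symmetric])
  then show ?thesis
    unfolding complex_norm_square cnj_sum sum_product
    by (intro sum.cong refl) (simp add: cnj_unit_root)
qed

text \<open>With R = S^H S the quadratic form of R is a squared norm of S applied to a vector, here
  the modulated indicator of A. It is the variance parameter of the Gaussian forms.\<close>

lemma toeplitz_form_eq_norm:
  assumes S: "S \<in> carrier_mat T T" and R: "mat_adjoint S * S = toeplitz T r" and A: "A \<subseteq> {..<T}"
  shows "complex_of_real (\<Sum>i<T. (cmod (\<Sum>s\<in>A. S $$ (i, s) * unit_root L l (int s)))\<^sup>2)
    = (\<Sum>s\<in>A. \<Sum>t\<in>A. r (int s - int t) * unit_root L l (int s - int t))"
proof -
  have "complex_of_real (\<Sum>i<T. (cmod (\<Sum>s\<in>A. S $$ (i, s) * unit_root L l (int s)))\<^sup>2)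
      = (\<Sum>s\<in>A. \<Sum>t\<in>A. \<Sum>i<T. S $$ (i, s) * cnj (S $$ (i, t)) * unit_root L l (int s - int t))"
    unfolding of_real_sum sq_cmod_sum_unit_root by (simp only: sum.swap[of _ "{..<T}" A])
  also have "\<dots> = (\<Sum>s\<in>A. \<Sum>t\<in>A. r (int s - int t) * unit_root L l (int s - int t))"
  proof (intro sum.cong refl)
    fix s t assume "s \<in> A" "t \<in> A"
    then have "s < T" "t < T" using A by auto
    then show "(\<Sum>i<T. S $$ (i, s) * cnj (S $$ (i, t)) * unit_root L l (int s - int t)) = r (int s - int t) * unit_root L l (int s - int t)"
      by (simp add: sum_distrib_right[symmetric] gram_toeplitz_entry[OF S R])
  qed
  finally show ?thesis .
qed

text \<open>For fixed s the lags s - t are distinct, so each row contributes at most the sum of all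
  |r k|. The variance is thus linear in the cardinality of A, uniformly in the frequency.\<close>

lemma toeplitz_form_le:
  assumes S: "S \<in> carrier_mat T T" and R: "mat_adjoint S * S = toeplitz T r" and A: "A \<subseteq> {..<T}"
    and r: "(\<lambda>k. cmod (r k)) summable_on UNIV"
  shows "(\<Sum>i<T. (cmod (\<Sum>s\<in>A. S $$ (i, s) * unit_root L l (int s)))\<^sup>2) \<le> (\<Sum>\<^sub>\<infinity>k. cmod (r k)) * real (card A)"
proof -
  have finA: "finite A" using A finite_subset by blast
  have row: "(\<Sum>t\<in>A. cmod (r (int s - int t))) \<le> (\<Sum>\<^sub>\<infinity>k. cmod (r k))" for s
  proof -
    have "(\<Sum>t\<in>A. cmod (r (int s - int t))) = (\<Sum>k\<in>(\<lambda>t. int s - int t) ` A. cmod (r k))"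
      by (subst sum.reindex) (auto simp: inj_on_def)
    also have "\<dots> \<le> (\<Sum>\<^sub>\<infinity>k. cmod (r k))"
      using r finA by (intro finite_sum_le_infsum) auto
    finally show ?thesis .
  qed
  have "(\<Sum>i<T. (cmod (\<Sum>s\<in>A. S $$ (i, s) * unit_root L l (int s)))\<^sup>2)
      = cmod (\<Sum>s\<in>A. \<Sum>t\<in>A. r (int s - int t) * unit_root L l (int s - int t))"
    unfolding toeplitz_form_eq_norm[OF S R A, symmetric] norm_of_real by (simp add: sum_nonneg)
  also have "\<dots> \<le> (\<Sum>s\<in>A. \<Sum>t\<in>A. cmod (r (int s - int t)))"
    by (intro sum_norm_le) (simp add: norm_mult)
  also have "\<dots> \<le> (\<Sum>s\<in>A. \<Sum>\<^sub>\<infinity>k. cmod (r k))"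
    by (intro sum_mono row)
  finally show ?thesis by (simp add: mult.commute)
qed

text \<open>Summing V over the modulated columns in A is applying the rows of W to the vector
  \<open>v\<close>. The empirical part becomes a mean of squared moduli of Gaussian forms, and the
  part from r is their variance by \<open>toeplitz_form_eq_norm\<close>.\<close>

lemma covariance_error_form:
  fixes L l N T :: nat
  assumes W: "W \<in> carrier_mat N T" and S: "S \<in> carrier_mat T T" and R: "mat_adjoint S * S = toeplitz T r"
    and A: "A \<subseteq> {..<T}" and N: "N > 0"
  defines "v i \<equiv> \<Sum>s\<in>A. S $$ (i, s) * unit_root L l (int s)"
  shows "(\<Sum>s\<in>A. \<Sum>t\<in>A. covariance_error (W * S) r s t * unit_root L l (int s - int t))
    = complex_of_real ((\<Sum>n<N. (cmod (\<Sum>i<T. W $$ (n, i) * v i))\<^sup>2 - (\<Sum>i<T. (cmod (v i))\<^sup>2)) / real N)"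
proof -
  let ?V = "W * S" and ?u = "unit_root L l"
  have Z: "(\<Sum>i<T. W $$ (n, i) * v i) = (\<Sum>s\<in>A. ?V $$ (n, s) * ?u (int s))" if "n < N" for n
  proof -
    have "?V $$ (n, s) = (\<Sum>i<T. W $$ (n, i) * S $$ (i, s))" if "s \<in> A" for s
    proof -
      have "s < T" using that A by auto
      then show ?thesis using W S \<open>n < N\<close>
        by (auto simp: scalar_prod_def lessThan_atLeast0 intro!: sum.cong)
    qed
    then have "(\<Sum>s\<in>A. ?V $$ (n, s) * ?u (int s)) = (\<Sum>s\<in>A. \<Sum>i<T. W $$ (n, i) * S $$ (i, s) * ?u (int s))"
      by (simp add: sum_distrib_right)
    also have "\<dots> = (\<Sum>i<T. W $$ (n, i) * v i)"
      unfolding v_def sum_distrib_left by (subst sum.swap) (simp add: mult.assoc)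
    finally show ?thesis by simp
  qed
  have "complex_of_real (\<Sum>n<N. (cmod (\<Sum>i<T. W $$ (n, i) * v i))\<^sup>2)
      = (\<Sum>n<N. \<Sum>s\<in>A. \<Sum>t\<in>A. ?V $$ (n, s) * cnj (?V $$ (n, t)) * ?u (int s - int t))"
    unfolding of_real_sum by (intro sum.cong refl) (simp only: lessThan_iff Z sq_cmod_sum_unit_root)
  also have "\<dots> = (\<Sum>s\<in>A. \<Sum>t\<in>A. (\<Sum>n<N. ?V $$ (n, s) * cnj (?V $$ (n, t))) * ?u (int s - int t))"
    by (simp only: sum.swap[of _ "{..<N}" A] sum_distrib_right)
  finally have sq: "complex_of_real (\<Sum>n<N. (cmod (\<Sum>i<T. W $$ (n, i) * v i))\<^sup>2)
      = (\<Sum>s\<in>A. \<Sum>t\<in>A. (\<Sum>n<N. ?V $$ (n, s) * cnj (?V $$ (n, t))) * ?u (int s - int t))" .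
  have "(\<Sum>n<N. (cmod (\<Sum>i<T. W $$ (n, i) * v i))\<^sup>2 - (\<Sum>i<T. (cmod (v i))\<^sup>2)) / real N
      = (\<Sum>n<N. (cmod (\<Sum>i<T. W $$ (n, i) * v i))\<^sup>2) / real N - (\<Sum>i<T. (cmod (v i))\<^sup>2)"
    using N by (simp add: sum_subtractf diff_divide_distrib)
  then have "complex_of_real ((\<Sum>n<N. (cmod (\<Sum>i<T. W $$ (n, i) * v i))\<^sup>2 - (\<Sum>i<T. (cmod (v i))\<^sup>2)) / real N)
      = complex_of_real (\<Sum>n<N. (cmod (\<Sum>i<T. W $$ (n, i) * v i))\<^sup>2) / of_nat N
        - complex_of_real (\<Sum>i<T. (cmod (v i))\<^sup>2)"
    by (simp only: of_real_diff of_real_divide of_real_of_nat_eq)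
  also have "\<dots> = (\<Sum>s\<in>A. \<Sum>t\<in>A. (\<Sum>n<N. ?V $$ (n, s) * cnj (?V $$ (n, t))) * ?u (int s - int t)) / of_nat N
        - (\<Sum>s\<in>A. \<Sum>t\<in>A. r (int s - int t) * ?u (int s - int t))"
    unfolding sq unfolding v_def toeplitz_form_eq_norm[OF S R A] ..
  also have "\<dots> = (\<Sum>s\<in>A. \<Sum>t\<in>A. covariance_error ?V r s t * ?u (int s - int t))"
    using W unfolding sum_divide_distrib by (simp add: covariance_error_def sum_subtractf left_diff_distrib)
  finally show ?thesis by simp
qed

lemma (in prob_space) uniform_error_tail:
  assumes W: "std_complex_gaussian_matrix N T W" and N: "N > 0" and x: "0 < x" "x \<le> 1"
    and S: "S \<in> carrier_mat T T" and R: "mat_adjoint S * S = toeplitz T r"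
    and V: "\<And>\<omega>. \<omega> \<in> space M \<Longrightarrow> V \<omega> = W \<omega> * S"
    and r: "(\<lambda>k. cmod (r k)) summable_on UNIV"
  obtains B where "B \<in> events" "prob B \<le> real (2 * T * (T + 1) ^ 4) * (4 * exp (- real N * x\<^sup>2 / 16))"
    "\<And>\<omega>. \<omega> \<in> space M - B \<Longrightarrow> uniform_error_le (V \<omega>) r ((\<Sum>\<^sub>\<infinity>k. cmod (r k)) * x)"
proof -
  define K where "K = (\<Sum>\<^sub>\<infinity>k. cmod (r k))"
  \<comment> \<open>The index set of the union bound: one frequency and four interval endpoints. Its
    size is polynomial in T.\<close>
  define P where "P = {..<2 * T} \<times> {..T} \<times> {..T} \<times> {..T} \<times> {..T}"
  have P: "finite P" "card P = 2 * T * (T + 1) ^ 4"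
    by (simp_all add: P_def card_cartesian_product power4_eq_xxxx)
  define u where "u = (\<lambda>(l, a, b, c, d) i. \<Sum>s\<in>{a..<b} \<union> {c..<d}. S $$ (i, s) * unit_root (2 * T) l (int s))"
  obtain B where B: "B \<in> events" "prob B \<le> real (card P) * (4 * exp (- real N * x\<^sup>2 / 16))"
    "\<And>\<omega> p. \<lbrakk>\<omega> \<in> space M - B; p \<in> P\<rbrakk> \<Longrightarrow>
      \<bar>\<Sum>n<N. (cmod (\<Sum>i<T. W \<omega> $$ (n, i) * u p i))\<^sup>2 - (\<Sum>i<T. (cmod (u p i))\<^sup>2)\<bar>
      \<le> real N * (\<Sum>i<T. (cmod (u p i))\<^sup>2) * x"
    using gaussian_matrix_uniform_concentration[OF W P(1) x, of "\<lambda>p. \<Sum>i<T. (cmod (u p i))\<^sup>2" u] by blast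
  show ?thesis
  proof (rule that[OF B(1)])
    show "prob B \<le> real (2 * T * (T + 1) ^ 4) * (4 * exp (- real N * x\<^sup>2 / 16))"
      using B(2) P(2) by simp
    fix \<omega> assume \<omega>: "\<omega> \<in> space M - B"
    then have W\<omega>: "W \<omega> \<in> carrier_mat N T" using W by (auto simp: std_complex_gaussian_matrix_def)
    have V\<omega>: "V \<omega> = W \<omega> * S" using V \<omega> by blast
    have dim: "dim_col (V \<omega>) = T" using S by (simp add: V\<omega>)
    show "uniform_error_le (V \<omega>) r ((\<Sum>\<^sub>\<infinity>k. cmod (r k)) * x)"
      unfolding uniform_error_le_def dim K_def[symmetric]
    proof (intro allI impI)
      fix l a b c d assume l: "l < 2 * T" and abcd: "a \<le> T" "b \<le> T" "c \<le> T" "d \<le> T"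
      let ?A = "{a..<b} \<union> {c..<d}"
      define p where "p = (l, a, b, c, d)"
      have p: "p \<in> P" using l abcd by (simp add: P_def p_def)
      have A: "?A \<subseteq> {..<T}" using abcd by auto
      have u: "u p i = (\<Sum>s\<in>?A. S $$ (i, s) * unit_root (2 * T) l (int s))" for i
        by (simp add: u_def p_def)
      have "cmod (\<Sum>s\<in>?A. \<Sum>t\<in>?A. covariance_error (V \<omega>) r s t * unit_root (2 * T) l (int s - int t))
          = \<bar>\<Sum>n<N. (cmod (\<Sum>i<T. W \<omega> $$ (n, i) * u p i))\<^sup>2 - (\<Sum>i<T. (cmod (u p i))\<^sup>2)\<bar> / real N"
        unfolding V\<omega> covariance_error_form[OF W\<omega> S R A N] u norm_of_real by simp
      also have "\<dots> \<le> real N * (\<Sum>i<T. (cmod (u p i))\<^sup>2) * x / real N"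
        by (intro divide_right_mono B(3)[OF \<omega> p]) simp
      also have "\<dots> = (\<Sum>i<T. (cmod (u p i))\<^sup>2) * x"
        using N by simp
      also have "\<dots> \<le> K * real (card ?A) * x"
        unfolding K_def u using x by (intro mult_right_mono toeplitz_form_le[OF S R A r]) auto
      finally show "cmod (\<Sum>s\<in>?A. \<Sum>t\<in>?A. covariance_error (V \<omega>) r s t * unit_root (2 * T) l (int s - int t))
          \<le> K * x * real (card ?A)" by (simp add: mult_ac)
    qed
  qed
qed

section \<open>Borel-Cantelli and the limit\<close>

lemma tail_summable:
  fixes N :: "nat \<Rightarrow> nat"
  assumes c: "0 < c" and N: "(\<lambda>T. real (N T) / real T) \<longlonglongrightarrow> c"
  shows "summable (\<lambda>T. real (2 * T * (T + 1) ^ 4) * (4 * exp (- real (N T) * (real T powr (- (1 / 4)))\<^sup>2 / 16)))"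
proof (rule summable_comparison_test_ev)
  show "summable (\<lambda>T. 1 / real T ^ 2)"
    using inverse_power_summable[of 2, where 'a = real] by (simp add: inverse_eq_divide)
  \<comment> \<open>Eventually N > c T/2, and T times the square of T^(-1/4) is sqrt T; with the 16
    of the Chernoff exponent this gives c/32. The decay exp(-d sqrt T) beats every power of
    T.\<close>
  define d where "d = c / 32"
  have d: "d > 0" using c by (simp add: d_def)
  have "((\<lambda>T::real. (2 * T * (T + 1) ^ 4) * (4 * exp (- d * sqrt T)) * T ^ 2) \<longlongrightarrow> 0) at_top"
    using d by real_asymp
  then have "(\<lambda>T. (2 * real T * (real T + 1) ^ 4) * (4 * exp (- d * sqrt (real T))) * real T ^ 2) \<longlonglongrightarrow> 0"
    by (rule filterlim_compose) (rule filterlim_real_sequentially)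
  then have "\<forall>\<^sub>F T in sequentially. (2 * real T * (real T + 1) ^ 4) * (4 * exp (- d * sqrt (real T))) * real T ^ 2 < 1"
    by (rule order_tendstoD) simp
  moreover have "\<forall>\<^sub>F T in sequentially. c / 2 < real (N T) / real T"
    using c by (intro order_tendstoD(1)[OF N]) simp
  ultimately show "\<forall>\<^sub>F T in sequentially. norm (real (2 * T * (T + 1) ^ 4) * (4 * exp (- real (N T) * (real T powr (- (1 / 4)))\<^sup>2 / 16)))
      \<le> 1 / real T ^ 2"
    using eventually_gt_at_top[of 0]
  proof eventually_elim
    case (elim T)
    have "(real T powr (- (1 / 4)))\<^sup>2 = real T powr (- (1 / 2))"
      using elim by (simp add: powr_power)
    also have "\<dots> = sqrt (real T) / real T"
      using elim by (simp add: powr_minus powr_half_sqrt field_simps)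
    finally have "- real (N T) * (real T powr (- (1 / 4)))\<^sup>2 / 16 = - (real (N T) / real T * sqrt (real T) / 16)" by simp
    also have "\<dots> \<le> - (c / 2 * sqrt (real T) / 16)"
      using elim by (intro le_imp_neg_le divide_right_mono mult_right_mono) auto
    also have "\<dots> = - d * sqrt (real T)" by (simp add: d_def)
    finally have "exp (- real (N T) * (real T powr (- (1 / 4)))\<^sup>2 / 16) \<le> exp (- d * sqrt (real T))" by simp
    then have "real (2 * T * (T + 1) ^ 4) * (4 * exp (- real (N T) * (real T powr (- (1 / 4)))\<^sup>2 / 16))
        \<le> (2 * real T * (real T + 1) ^ 4) * (4 * exp (- d * sqrt (real T)))"
      by (simp add: add.commute mult_left_mono)
    also have "\<dots> \<le> 1 / real T ^ 2"
      using elim by (simp add: field_simps)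
    finally show ?case by simp
  qed
qed

theorem mainTheorem3:
  fixes M :: "'a measure"
    and r :: "int \<Rightarrow> complex"
    and N :: "nat \<Rightarrow> nat"
    and c :: real
    and S :: "nat \<Rightarrow> complex mat"
    and W V :: "nat \<Rightarrow> 'a \<Rightarrow> complex mat"
  assumes "prob_space M"
    and "covariance_coefficients r"
    and "(\<lambda>k. cmod (r k)) summable_on UNIV"
    and "r 0 \<noteq> 0"
    and "\<And>T. T \<ge> 1 \<Longrightarrow> N T > 0"
    and "0 < c"
    and "(\<lambda>T. real (N T) / real T) \<longlonglongrightarrow> c"
    and "\<And>T. T \<ge> 1 \<Longrightarrow> S T \<in> carrier_mat T T"
    and "\<And>T. T \<ge> 1 \<Longrightarrow> mat_adjoint (S T) * S T = toeplitz T r"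
    and "\<And>T. T \<ge> 1 \<Longrightarrow> prob_space.std_complex_gaussian_matrix M (N T) T (W T)"
    and "\<And>T \<omega>. T \<ge> 1 \<Longrightarrow> \<omega> \<in> space M \<Longrightarrow> V T \<omega> = W T \<omega> * S T"
  shows "(AE \<omega> in M. (\<lambda>T. spectral_norm (biased_estimator (V T \<omega>) - toeplitz T r)) \<longlonglongrightarrow> 0) \<and>
         (AE \<omega> in M. (\<lambda>T. spectral_norm (unbiased_estimator (V T \<omega>) - toeplitz T r)) \<longlonglongrightarrow> 0)"
proof -
  interpret prob_space M by fact
  note r = assms(3) and N = assms(5) and S = assms(8) and R = assms(9) and W = assms(10) and V = assms(11)
  define K where "K = (\<Sum>\<^sub>\<infinity>k. cmod (r k))"
  \<comment> \<open>Any exponent strictly between -1/2 and 0 would do: T x^2 must grow like a power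
    of T for summability, while x log(T)^2 must vanish for the error bounds.\<close>
  define x where "x T = real T powr (- (1 / 4))" for T :: nat
  define p where "p T = real (2 * T * (T + 1) ^ 4) * (4 * exp (- real (N T) * (x T)\<^sup>2 / 16))" for T
  have x: "0 < x T" "x T \<le> 1" if "T \<ge> 1" for T
    using that powr_mono[of "- (1 / 4)" 0 "real T"] by (auto simp: x_def)
  have K: "0 \<le> K" unfolding K_def by (intro infsum_nonneg) auto
  have "\<exists>B. B \<in> events \<and> prob B \<le> p T \<and> (T \<ge> 1 \<longrightarrow> (\<forall>\<omega>\<in>space M - B. uniform_error_le (V T \<omega>) r (K * x T)))" for T
  proof (cases "T \<ge> 1")
    case True
    obtain B where "B \<in> events" "prob B \<le> real (2 * T * (T + 1) ^ 4) * (4 * exp (- real (N T) * (x T)\<^sup>2 / 16))"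
      "\<And>\<omega>. \<omega> \<in> space M - B \<Longrightarrow> uniform_error_le (V T \<omega>) r ((\<Sum>\<^sub>\<infinity>k. cmod (r k)) * x T)"
      using uniform_error_tail[OF W[OF True] N[OF True] x[OF True] S[OF True] R[OF True] V[OF True] r] by blast
    then show ?thesis unfolding p_def K_def by blast
  next
    \<comment> \<open>At T = 0 the bound \<open>p T\<close> is 0 and the empty event satisfies it,
      which makes \<open>B\<close> a sequence over all naturals.\<close>
    case False
    then show ?thesis by (intro exI[of _ "{}"]) (auto simp: p_def)
  qed
  then obtain B where B: "\<And>T. B T \<in> events" "\<And>T. prob (B T) \<le> p T"
    "\<And>T \<omega>. \<lbrakk>T \<ge> 1; \<omega> \<in> space M - B T\<rbrakk> \<Longrightarrow> uniform_error_le (V T \<omega>) r (K * x T)"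
    by metis
  have "summable (\<lambda>T. prob (B T))"
  proof (rule summable_comparison_test)
    show "summable p" unfolding p_def x_def by (rule tail_summable) fact+
    show "\<exists>n0. \<forall>T\<ge>n0. norm (prob (B T)) \<le> p T" using B(2) by auto
  qed
  \<comment> \<open>Only the individual probabilities enter here, so the matrices for different T
    may have any joint law.\<close>
  then have AE: "AE \<omega> in M. \<forall>\<^sub>F T in sequentially. \<omega> \<in> space M - B T"
    using B(1) by (intro borel_cantelli_AE1) (auto simp: less_top[symmetric])
  define f where "f T = K * x T + (\<Sum>k\<in>{- int T<..<int T}. real_of_int \<bar>k\<bar> / real T * cmod (r k))" for T
  define g where "g T = K * x T * (1 + 4 * (log 2 (real T) + 1) * (1 + ln (real T)))" for T
  have f: "f \<longlonglongrightarrow> 0"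
  proof -
    have "(\<lambda>T. K * x T) \<longlonglongrightarrow> 0" unfolding x_def by real_asymp
    from tendsto_add[OF this bias_tendsto_0[OF r]] show ?thesis by (simp add: f_def[abs_def])
  qed
  have g: "g \<longlonglongrightarrow> 0"
  proof -
    have "(\<lambda>T. x T * (1 + 4 * (log 2 (real T) + 1) * (1 + ln (real T)))) \<longlonglongrightarrow> 0"
      unfolding x_def by real_asymp
    from tendsto_mult_left[OF this, of K] show ?thesis by (simp add: g_def[abs_def] mult.assoc)
  qed
  have bound: "norm (spectral_norm (biased_estimator (V T \<omega>) - toeplitz T r)) \<le> f T \<and>
      norm (spectral_norm (unbiased_estimator (V T \<omega>) - toeplitz T r)) \<le> g T"
    if T: "T \<ge> 1" and \<omega>: "\<omega> \<in> space M - B T" for T \<omega>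
  proof -
    have V\<omega>: "V T \<omega> = W T \<omega> * S T" using V T \<omega> by blast
    have "W T \<omega> \<in> carrier_mat (N T) T"
      using W[OF T] \<omega> by (auto simp: std_complex_gaussian_matrix_def)
    then have dims: "T = dim_col (V T \<omega>)" "dim_row (V T \<omega>) > 0"
      using S[OF T] N[OF T] by (auto simp: V\<omega>)
    have Kx: "0 \<le> K * x T" using K x(1)[OF T] by simp
    \<comment> \<open>The number of halvings: large enough for T <= 2^D, yet at most log2 T + 1, so
      the unbiased bound loses only a squared logarithm.\<close>
    define D where "D = nat \<lceil>log 2 (real T)\<rceil>"
    have "log 2 (real T) \<ge> 0" using T by simp
    then have D: "log 2 (real T) \<le> real D" "real D \<le> log 2 (real T) + 1"
      unfolding D_def by linarith+
    have "real T = 2 powr log 2 (real T)" using T by simp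
    also have "\<dots> \<le> 2 powr real D" using D(1) by (intro powr_mono) auto
    finally have "real T \<le> real (2 ^ D)" by (simp add: powr_realpow)
    then have TD: "T \<le> 2 ^ D" by (simp only: of_nat_le_iff)
    have "\<bar>spectral_norm (unbiased_estimator (V T \<omega>) - toeplitz T r)\<bar> \<le> K * x T * (1 + 4 * real D * (1 + ln (real T)))"
      by (rule unbiased_estimator_error[OF dims(1) T TD dims(2) B(3)[OF T \<omega>] Kx])
    also have "\<dots> \<le> g T"
      unfolding g_def using D(2) T Kx by (intro mult_left_mono add_left_mono mult_right_mono) auto
    finally show ?thesis
      using biased_estimator_error[OF dims(1) T dims(2) B(3)[OF T \<omega>]] by (simp add: f_def)
  qed
  have ev: "\<forall>\<^sub>F T in sequentially. norm (spectral_norm (biased_estimator (V T \<omega>) - toeplitz T r)) \<le> f T \<and>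
      norm (spectral_norm (unbiased_estimator (V T \<omega>) - toeplitz T r)) \<le> g T"
    if "\<forall>\<^sub>F T in sequentially. \<omega> \<in> space M - B T" for \<omega>
    using that eventually_ge_at_top[of 1]
  proof eventually_elim
    case (elim T)
    then show ?case using bound by blast
  qed
  \<comment> \<open>One almost sure event serves both estimators: on it the bounds \<open>f\<close>
    and \<open>g\<close> hold for all large T and squeeze the norms to 0.\<close>
  show ?thesis
    using AE by (intro conjI; eventually_elim)
      (blast intro: Lim_null_comparison[OF _ f] Lim_null_comparison[OF _ g] eventually_mono[OF ev])+
qed

end
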